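(* Let $k\equiv0\pmod4$ be a positive integer and $m\ge1$. Let $f=E_k(\tau)=1+\frac{(2\pi)^k}{\zeta(k)\Gamma(k)}\sum_{n\ge1}\sigma_{k-1}(n)e^{2\pi in\tau}$, let $\Lambda_f(s)=(2\pi)^{-s}\Gamma(s)L_f(s)$ (meromorphically continued), and let $\widetilde\Lambda_f(s):=\Lambda_f(s)/\cos(\pi s/2)$. Then all zeros of $$P_f^m(z):=\sum_{\substack{n=1\\ n\text{ odd}}}^{k-3}\binom{k-2}{n}i^{1-n}\widetilde\Lambda_f^{(m)}(n+1)z^{k-3-n}$$ lie on the unit circle.
   Context: $\sigma_{k-1}(n)=\sum_{d\mid n}d^{k-1}$; for $f=\sum a_ne^{2\pi in\tau}$, $L_f(s)=\sum_{n\ge1}a_nn^{-s}$. For $f=E_k$ one has $L_f(s)=c\,\zeta(s)\zeta(s-k+1)$ for a constant $c$, and $\widetilde\Lambda_f$ is meromorphic on $\mathbb C$ (holomorphic at even integers $2\le s\le k-2$); $\widetilde\Lambda_f^{(m)}$ denotes its $m$-th derivative.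
   Formalization: The case k = 4 with m odd is excluded: there the symmetry s ↦ 4 − s gives Λ̃_f^{(m)}(2) = 0, so P_f^m is identically zero and every z is a zero, making the claim as stated false. *)

theory Defs
  imports "HOL-Complex_Analysis.Complex_Analysis" "HOL-Number_Theory.Cong"
begin

definition divisor_sigma :: "nat \<Rightarrow> nat \<Rightarrow> nat" where
  "divisor_sigma r n = (\<Sum>d | d dvd n. d ^ r)"

text \<open>The Riemann zeta function at integers \<open>k \<ge> 2\<close>, as a convergent series.\<close>

definition zeta_nat :: "nat \<Rightarrow> real" where
  "zeta_nat k = (\<Sum>n. 1 / real (Suc n) ^ k)"

text \<open>
  The sign of the nonconstant part is the one for \<open>4 dvd k\<close>; for general even weight the
  Eisenstein series carries a factor \<open>\<i> ^ k\<close> there.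
\<close>

definition eisenstein_E :: "nat \<Rightarrow> complex \<Rightarrow> complex" where
  "eisenstein_E k \<tau> =
     1 + of_real ((2 * pi) ^ k / (zeta_nat k * Gamma (real k))) *
         (\<Sum>n. of_nat (divisor_sigma (k - 1) (Suc n)) *
               exp (2 * of_real pi * \<i> * of_nat (Suc n) * \<tau>))"

text \<open>The expansion determines the coefficients, since it is a power series in
  \<open>exp (2 * pi * \<i> * \<tau>)\<close>, which takes every value in the punctured unit disc.\<close>

definition fourier_coeff :: "(complex \<Rightarrow> complex) \<Rightarrow> nat \<Rightarrow> complex" where
  "fourier_coeff f = (THE a. \<forall>\<tau>. Im \<tau> > 0 \<longrightarrow>
     (\<lambda>n. a n * exp (2 * of_real pi * \<i> * of_nat n * \<tau>)) sums f \<tau>)"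

definition L_series :: "(complex \<Rightarrow> complex) \<Rightarrow> complex \<Rightarrow> complex" where
  "L_series f s = (\<Sum>n. fourier_coeff f (Suc n) * of_nat (Suc n) powr (-s))"

text \<open>
  The meromorphic continuation to the whole plane of a function given on some right half-plane.
  By the identity theorem it is unique if it exists, and does not depend on the half-plane:
  \<open>nicely_meromorphic_on\<close> fixes the values at removable singularities and at poles.
\<close>

definition meromorphic_continuation :: "(complex \<Rightarrow> complex) \<Rightarrow> complex \<Rightarrow> complex" where
  "meromorphic_continuation F = (THE G. G nicely_meromorphic_on UNIV \<and>
     (\<exists>c::real. \<forall>s. Re s > c \<longrightarrow> G s = F s))"

definition completed_L :: "(complex \<Rightarrow> complex) \<Rightarrow> complex \<Rightarrow> complex" where
  "completed_L f =
     meromorphic_continuation (\<lambda>s. of_real (2 * pi) powr (-s) * Gamma s * L_series f s)"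

text \<open>At the zeros of the cosine, the odd integers, this takes the value 0 by the convention
  for division; it is only used near even integers.\<close>

definition completed_L_tilde :: "(complex \<Rightarrow> complex) \<Rightarrow> complex \<Rightarrow> complex" where
  "completed_L_tilde f s = completed_L f s / cos (of_real pi * s / 2)"

definition period_poly_deriv :: "(complex \<Rightarrow> complex) \<Rightarrow> nat \<Rightarrow> nat \<Rightarrow> complex \<Rightarrow> complex" where
  "period_poly_deriv f k m z =
     (\<Sum>n | n \<in> {1..k - 3} \<and> odd n.
        of_nat ((k - 2) choose n) * \<i> powi (1 - int n) *
        (deriv ^^ m) (completed_L_tilde f) (of_nat (n + 1)) * z ^ (k - 3 - n))"

end

theory Submission
  imports Defs "HOL-Computational_Algebra.Fundamental_Theorem_Algebra"
begin

text \<open>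
  The functional equation of the zeta function turns \<open>\<Lambda>(s) / cos (\<pi> s / 2)\<close> into a constant multiple
  of \<open>p(s) h(s)\<close> with \<open>p(s) = \<Gamma>(s) \<Gamma>(k - s)\<close> and \<open>h(s) = \<zeta>(s) \<zeta>(k - s)\<close>, on the strip
  \<open>1 < Re s < k - 1\<close>. The binomial coefficient in the polynomial is \<open>(k - 2)! / p(n + 1)\<close>, so up to a
  constant the coefficients are the values of \<open>F\<^sub>m = (p h)\<^bsup>(m)\<^esup> / p\<close> at even integers. With
  \<open>L = p' / p = \<psi>(s) - \<psi>(k - s)\<close> one has \<open>F\<^sub>0 = h\<close> and \<open>F\<^sub>m\<^sub>+\<^sub>1 = F\<^sub>m' + L F\<^sub>m\<close>. Both \<open>h\<close> and \<open>L\<close> have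
  nonnegative Taylor coefficients at the centre \<open>k / 2\<close>, hence so has every \<open>F\<^sub>m\<close>: it is nonnegative and
  nondecreasing to the right of \<open>k / 2\<close>, and even or odd under \<open>s \<mapsto> k - s\<close>. As a polynomial in
  \<open>- z\<^sup>2\<close> the period polynomial is thus (anti)palindromic with coefficients increasing from the middle,
  and the theorem of Enestroem and Kakeya forces its zeros onto the unit circle.

  The functional equation results from integrating the partial fraction expansion of
  \<open>1 / (exp x - 1) - 1 / x + 1 / 2\<close>, which is that of the cotangent, termwise against \<open>x powr (s - 1)\<close>.
\<close>

section \<open>Polynomials whose coefficients increase from the middle\<close>

lemma linear_mult_power_sum:
  fixes w :: "'a :: comm_ring_1"
  shows "(w - 1) * (\<Sum>i\<le>n. a i * w ^ i) = a n * w ^ Suc n - a 0 - (\<Sum>i<n. (a (Suc i) - a i) * w ^ Suc i)"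
  by (induction n) (simp_all add: algebra_simps)

lemma enestrom_kakeya:
  fixes p :: "real poly"
  assumes mono: "\<And>i. i < degree p \<Longrightarrow> coeff p i \<le> coeff p (Suc i)"
    and nonneg: "0 \<le> coeff p 0" and "p \<noteq> 0"
    and zero: "poly (map_poly complex_of_real p) w = 0"
  shows "norm w \<le> 1"
proof (rule ccontr)
  assume "\<not> norm w \<le> 1"
  hence w: "1 < norm w" by simp
  define N where "N = degree p"
  have "0 \<le> coeff p i" if "i \<le> N" for i
    using that nonneg by (induction i) (auto simp: N_def Suc_le_eq intro: order_trans mono)
  hence lead: "0 < coeff p N"
    using \<open>p \<noteq> 0\<close> by (simp add: N_def order.strict_iff_order)
  have "(\<Sum>i\<le>N. of_real (coeff p i) * w ^ i) = 0"
    using zero by (simp add: poly_altdef coeff_map_poly degree_map_poly N_def)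
  with linear_mult_power_sum[of w "\<lambda>i. of_real (coeff p i)" N]
  have top: "of_real (coeff p N) * w ^ Suc N =
      of_real (coeff p 0) + (\<Sum>i<N. of_real (coeff p (Suc i) - coeff p i) * w ^ Suc i)"
    by (simp add: algebra_simps)
  have "coeff p N * norm w ^ Suc N = norm (of_real (coeff p N) * w ^ Suc N)"
    using lead by (simp add: norm_mult norm_power)
  also have "\<dots> \<le> norm (of_real (coeff p 0) :: complex) +
      (\<Sum>i<N. norm (of_real (coeff p (Suc i) - coeff p i) * w ^ Suc i))"
    unfolding top by (intro order_trans[OF norm_triangle_ineq] add_left_mono norm_sum)
  also have "\<dots> \<le> coeff p 0 * norm w ^ N + (\<Sum>i<N. (coeff p (Suc i) - coeff p i) * norm w ^ N)"
  proof (intro add_mono sum_mono)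
    show "norm (of_real (coeff p 0) :: complex) \<le> coeff p 0 * norm w ^ N"
      using nonneg w by (simp add: mult_le_cancel_left1 one_le_power)
    fix i assume "i \<in> {..<N}"
    thus "norm (of_real (coeff p (Suc i) - coeff p i) * w ^ Suc i)
          \<le> (coeff p (Suc i) - coeff p i) * norm w ^ N"
      unfolding norm_mult norm_of_real norm_power
      using mono[of i] w by (intro mult_mono power_increasing) (auto simp: N_def)
  qed
  also have "\<dots> = coeff p N * norm w ^ N"
    by (simp add: sum_distrib_right[symmetric] sum_lessThan_telescope distrib_right[symmetric])
  finally have "norm w ^ Suc N \<le> norm w ^ N"
    using lead by (simp del: power_Suc)
  with w show False
    by (simp add: power_increasing_iff[OF w] del: power_Suc)
qed

lemma norm_one_minus_mult_le:
  fixes r w :: complex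
  assumes "norm r \<le> 1" "1 \<le> norm w"
  shows "norm (1 - r * w) \<le> norm (cnj w - r)"
proof -
  have "(norm (1 - r * w))\<^sup>2 - (norm (cnj w - r))\<^sup>2 = (1 - (norm r)\<^sup>2) * (1 - (norm w)\<^sup>2)"
    unfolding cmod_power2 by (simp add: power2_eq_square algebra_simps)
  also have "\<dots> \<le> 0"
    using assms by (intro mult_nonneg_nonpos) (auto simp: power_le_one)
  finally show ?thesis
    by (simp add: power_mono_iff)
qed

lemma norm_poly_reflect_poly_le:
  fixes p :: "complex poly"
  assumes roots: "\<And>z. poly p z = 0 \<Longrightarrow> norm z \<le> 1" and w: "1 \<le> norm w"
  shows "norm (poly (reflect_poly p) w) \<le> norm (poly p (cnj w))"
proof (cases "p = 0")
  case False
  define n where "n = degree p"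
  obtain root where "smult (lead_coeff p) (\<Prod>i<n. [:-root i, 1:]) = p"
    using complex_poly_decompose'[of p] unfolding n_def by metis
  hence poly_p: "poly p z = lead_coeff p * (\<Prod>i<n. z - root i)" for z
    by (metis (no_types, lifting) poly_smult poly_prod poly_pCons poly_0 mult_zero_right add.right_neutral
        mult.right_neutral diff_conv_add_uminus add.commute prod.cong)
  have root: "norm (root i) \<le> 1" if "i < n" for i
    using roots[of "root i"] that by (auto simp: poly_p)
  have "w \<noteq> 0" using w by auto
  hence "norm (poly (reflect_poly p) w) = norm (lead_coeff p) * (\<Prod>i<n. norm (w * (inverse w - root i)))"
    by (simp add: poly_reflect_poly_nz poly_p norm_mult norm_power prod.distrib flip: n_def prod_norm)
  also have "\<dots> = norm (lead_coeff p) * (\<Prod>i<n. norm (1 - root i * w))"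
    using \<open>w \<noteq> 0\<close> by (simp add: right_diff_distrib mult.commute)
  also have "\<dots> \<le> norm (lead_coeff p) * (\<Prod>i<n. norm (cnj w - root i))"
    using w root by (intro mult_left_mono prod_mono conjI norm_one_minus_mult_le) auto
  also have "\<dots> = norm (poly p (cnj w))"
    by (simp add: poly_p norm_mult prod_norm)
  finally show ?thesis .
qed simp

lemma norm_reflect_poly_less_power_mult:
  fixes p :: "complex poly"
  assumes roots: "\<And>z. poly p z = 0 \<Longrightarrow> norm z \<le> 1" and real: "\<And>i. coeff p i \<in> \<real>"
    and "0 < n" "1 < norm u"
  shows "norm (poly (reflect_poly p) u) < norm (u ^ n * poly p u)"
proof -
  have "poly p u \<noteq> 0"
    using roots[of u] \<open>1 < norm u\<close> by auto
  have "norm (poly (reflect_poly p) u) \<le> norm (poly p u)"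
    using norm_poly_reflect_poly_le[of p u] roots \<open>1 < norm u\<close>
    by (simp add: poly_cnj_real[OF real, symmetric])
  also have "\<dots> < norm u ^ n * norm (poly p u)"
    using assms(3,4) \<open>poly p u \<noteq> 0\<close> by (simp add: one_less_power)
  finally show ?thesis
    by (simp add: norm_mult norm_power)
qed

lemma roots_of_monom_mult_plus_reflect_poly:
  fixes p :: "complex poly"
  assumes roots: "\<And>z. poly p z = 0 \<Longrightarrow> norm z \<le> 1" and real: "\<And>i. coeff p i \<in> \<real>" and "p \<noteq> 0"
    and "0 < n" and \<epsilon>: "norm \<epsilon> = 1"
    and zero: "poly (monom 1 n * p + smult \<epsilon> (reflect_poly p)) w = 0"
  shows "norm w = 1"
proof -
  have dominated: "norm (poly (reflect_poly p) u) < norm (u ^ n * poly p u)" if "1 < norm u" for u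
    using roots real \<open>0 < n\<close> that by (rule norm_reflect_poly_less_power_mult)
  have balance: "w ^ n * poly p w = - (\<epsilon> * poly (reflect_poly p) w)"
    using zero by (simp add: poly_monom eq_neg_iff_add_eq_0)
  have "\<not> 1 < norm w"
    using dominated[of w] arg_cong[OF balance, of norm] \<epsilon> by (auto simp: norm_mult)
  moreover have "\<not> norm w < 1"
  proof
    assume "norm w < 1"
    have "w \<noteq> 0"
      using balance \<epsilon> \<open>0 < n\<close> \<open>p \<noteq> 0\<close> by (auto simp: power_0_left)
    define u where "u = inverse w"
    have "1 < norm u"
      using \<open>w \<noteq> 0\<close> \<open>norm w < 1\<close> by (simp add: u_def norm_inverse one_less_inverse)
    have "u ^ n * w ^ n = 1"
      using \<open>w \<noteq> 0\<close> by (simp add: u_def power_inverse)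
    have reflect: "poly (reflect_poly p) w = w ^ degree p * poly p u"
      "poly p w = w ^ degree p * poly (reflect_poly p) u"
      using \<open>w \<noteq> 0\<close> by (simp_all add: poly_reflect_poly_nz u_def power_inverse)
    have "w ^ degree p * (w ^ n * poly (reflect_poly p) u) = w ^ degree p * - (\<epsilon> * poly p u)"
      using balance unfolding reflect by (simp add: mult_ac)
    hence "w ^ n * poly (reflect_poly p) u = - (\<epsilon> * poly p u)"
      using \<open>w \<noteq> 0\<close> by (subst (asm) mult_cancel_left) simp
    hence "u ^ n * w ^ n * poly (reflect_poly p) u = - (\<epsilon> * (u ^ n * poly p u))"
      by (simp add: mult_ac)
    hence "poly (reflect_poly p) u = - (\<epsilon> * (u ^ n * poly p u))"
      by (simp add: \<open>u ^ n * w ^ n = 1\<close>)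
    with dominated[OF \<open>1 < norm u\<close>] \<epsilon> show False
      by (simp add: norm_mult)
  qed
  ultimately show ?thesis by simp
qed

text \<open>Half of the middle coefficient goes to each of the two halves of a self-reciprocal polynomial.\<close>

definition upper_half :: "nat \<Rightarrow> real poly \<Rightarrow> real poly" where
  "upper_half N P = poly_shift N P - [:coeff P N / 2:]"

lemma coeff_upper_half:
  "coeff (upper_half N P) i = (if i = 0 then coeff P N / 2 else coeff P (N + i))"
  by (cases i) (simp_all add: upper_half_def coeff_poly_shift add.commute)

lemma degree_upper_half:
  assumes "N < degree P"
  shows "degree (upper_half N P) = degree P - N"
proof (rule antisym)
  show "degree (upper_half N P) \<le> degree P - N"
    using assms by (intro degree_le) (auto simp: coeff_upper_half coeff_eq_0)
  have "P \<noteq> 0" using assms by auto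
  thus "degree P - N \<le> degree (upper_half N P)"
    using assms by (intro le_degree) (simp add: coeff_upper_half)
qed

lemma self_reciprocal_eq_upper_half:
  fixes P :: "real poly"
  assumes deg: "degree P = 2 * N" and "0 < N"
    and sym: "\<And>j. j \<le> 2 * N \<Longrightarrow> coeff P (2 * N - j) = \<epsilon> * coeff P j"
  shows "P = monom 1 N * upper_half N P + smult \<epsilon> (reflect_poly (upper_half N P))"
proof (rule poly_eqI)
  fix j
  have "degree (upper_half N P) = N"
    using degree_upper_half[of N P] deg \<open>0 < N\<close> by simp
  note coeffs = coeff_monom_mult coeff_reflect_poly coeff_upper_half this
  consider "j < N" | "j = N" | "N < j" by linarith
  thus "coeff P j = coeff (monom 1 N * upper_half N P + smult \<epsilon> (reflect_poly (upper_half N P))) j"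
  proof cases
    assume "j < N"
    thus ?thesis using sym[of "2 * N - j"] by (simp add: coeffs mult_2)
  next
    assume "j = N"
    thus ?thesis using sym[of N] by (auto simp: coeffs)
  next
    assume "N < j"
    thus ?thesis by (simp add: coeffs)
  qed
qed

lemma upper_half_roots:
  assumes "N < degree P" and mono: "\<And>i. N + i < degree P \<Longrightarrow> coeff P (N + i) \<le> coeff P (N + Suc i)"
    and "0 \<le> coeff P N" and zero: "poly (map_poly complex_of_real (upper_half N P)) z = 0"
  shows "norm z \<le> 1"
  using _ _ _ zero
proof (rule enestrom_kakeya)
  show "coeff (upper_half N P) i \<le> coeff (upper_half N P) (Suc i)" if "i < degree (upper_half N P)" for i
    using mono[of i] that assms(1,3) by (cases "i = 0") (simp_all add: coeff_upper_half degree_upper_half)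
  show "0 \<le> coeff (upper_half N P) 0"
    using \<open>0 \<le> coeff P N\<close> by (simp add: coeff_upper_half)
  show "upper_half N P \<noteq> 0"
    using degree_upper_half[OF assms(1)] assms(1) by auto
qed

lemma self_reciprocal_roots_on_unit_circle:
  fixes P :: "real poly"
  assumes deg: "degree P = 2 * N" and "P \<noteq> 0"
    and sym: "\<And>j. j \<le> 2 * N \<Longrightarrow> coeff P (2 * N - j) = \<epsilon> * coeff P j" and \<epsilon>: "\<bar>\<epsilon>\<bar> = 1"
    and mono: "\<And>i. i < N \<Longrightarrow> coeff P (N + i) \<le> coeff P (N + Suc i)" and "0 \<le> coeff P N"
    and zero: "poly (map_poly complex_of_real P) w = 0"
  shows "norm w = 1"
proof (cases "N = 0")
  case True
  then obtain c where "P = [:c:]" using deg by (auto elim: degree_eq_zeroE)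
  with zero \<open>P \<noteq> 0\<close> show ?thesis by (simp add: map_poly_pCons)
next
  case False
  define p where "p = map_poly complex_of_real (upper_half N P)"
  have deg_p: "degree (upper_half N P) = N"
    using degree_upper_half[of N P] deg False by simp
  have "coeff P j = coeff (monom 1 N * upper_half N P + smult \<epsilon> (reflect_poly (upper_half N P))) j" for j
    using self_reciprocal_eq_upper_half[OF deg _ sym] False by simp
  hence "map_poly complex_of_real P = monom 1 N * p + smult (of_real \<epsilon>) (reflect_poly p)"
    by (intro poly_eqI)
      (simp add: p_def coeff_map_poly coeff_monom_mult coeff_reflect_poly degree_map_poly)
  hence "poly (monom 1 N * p + smult (of_real \<epsilon>) (reflect_poly p)) w = 0"
    using zero by simp
  thus ?thesis
  proof (rule roots_of_monom_mult_plus_reflect_poly[rotated -1])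
    show "norm z \<le> 1" if "poly p z = 0" for z
      using upper_half_roots[of N P z] that deg False mono \<open>0 \<le> coeff P N\<close> by (simp add: p_def)
    show "p \<noteq> 0"
      using deg_p False by (metis p_def degree_0 degree_map_poly of_real_eq_0_iff)
  qed (use False \<epsilon> in \<open>simp_all add: p_def coeff_map_poly\<close>)
qed

section \<open>The Dirichlet series of the zeta function\<close>

definition zeta_series :: "complex \<Rightarrow> complex" where
  "zeta_series s = (\<Sum>n. of_nat (Suc n) powr (-s))"

lemma norm_of_nat_powr: "norm (of_nat n powr s :: complex) = real n powr Re s"
  by (simp add: norm_powr_real_powr)

lemma summable_nat_powr: "c > 1 \<Longrightarrow> summable (\<lambda>n. real (Suc n) powr (-c))"
  by (subst summable_Suc_iff) (simp add: summable_real_powr_iff)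

lemma summable_norm_zeta_series:
  "Re s > 1 \<Longrightarrow> summable (\<lambda>n. norm (of_nat (Suc n) powr (-s) :: complex))"
  using summable_nat_powr[of "Re s"] by (simp only: norm_of_nat_powr uminus_complex.sel)

lemma zeta_series_sums:
  "Re s > 1 \<Longrightarrow> (\<lambda>n. of_nat (Suc n) powr (-s)) sums zeta_series s"
  unfolding zeta_series_def
  by (rule summable_sums[OF summable_norm_cancel[OF summable_norm_zeta_series]])

definition zeta_partial :: "nat \<Rightarrow> complex \<Rightarrow> complex" where
  "zeta_partial N s = (\<Sum>n<N. of_nat (Suc n) powr (-s))"

lemma holomorphic_zeta_partial: "zeta_partial N holomorphic_on A"
  unfolding zeta_partial_def by (intro holomorphic_intros) (simp del: of_nat_Suc)

lemma uniform_limit_zeta_partial: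
  assumes "c > 1"
  shows "uniform_limit {s. Re s \<ge> c} zeta_partial zeta_series sequentially"
proof -
  have "norm (of_nat (Suc n) powr (-s) :: complex) \<le> real (Suc n) powr (-c)"
    if "s \<in> {s. Re s \<ge> c}" for n s
    using that unfolding norm_of_nat_powr by (intro powr_mono) auto
  from Weierstrass_m_test[OF this summable_nat_powr[OF assms]] show ?thesis
    by (simp only: zeta_partial_def[abs_def] zeta_series_def[abs_def])
qed

lemma Re_pos_not_nonpos_Ints: "Re s > 0 \<Longrightarrow> s \<notin> \<int>\<^sub>\<le>\<^sub>0"
  by (auto elim!: nonpos_Ints_cases)

lemma Re_minus_dist_le: "Re c - dist c s \<le> Re s"
  using abs_Re_le_cmod[of "c - s"] by (simp add: dist_norm)

lemma holomorphic_zeta_series: "zeta_series holomorphic_on {s. Re s > 1}"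
proof (rule holomorphic_uniform_sequence[OF open_halfspace_Re_gt holomorphic_zeta_partial])
  fix s :: complex assume "s \<in> {s. Re s > 1}"
  hence s: "Re s > 1" by simp
  define d where "d = (Re s - 1) / 2"
  have "d > 0" "Re s - d = 1 + d"
    using s by (simp_all add: d_def field_simps)
  hence sub: "cball s d \<subseteq> {z. Re z \<ge> 1 + d}"
    by (auto intro: order_trans[OF _ Re_minus_dist_le[of s]])
  moreover have "cball s d \<subseteq> {s. Re s > 1}"
    using sub \<open>d > 0\<close> by fastforce
  moreover have "uniform_limit (cball s d) zeta_partial zeta_series sequentially"
    by (rule uniform_limit_on_subset[OF uniform_limit_zeta_partial sub]) (use \<open>d > 0\<close> in simp)
  ultimately show "\<exists>d>0. cball s d \<subseteq> {s. Re s > 1} \<and>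
      uniform_limit (cball s d) zeta_partial zeta_series sequentially"
    using \<open>d > 0\<close> by blast
qed

lemma holomorphic_on_zeta_series [holomorphic_intros]:
  assumes "f holomorphic_on A" "\<And>z. z \<in> A \<Longrightarrow> Re (f z) > 1"
  shows "(\<lambda>z. zeta_series (f z)) holomorphic_on A"
  using holomorphic_on_compose[OF assms(1) holomorphic_on_subset[OF holomorphic_zeta_series]] assms(2)
  by (auto simp: o_def image_subset_iff)

lemma zeta_series_of_real:
  assumes "x > 1"
  shows "zeta_series (of_real x) = of_real (\<Sum>n. real (Suc n) powr (-x))"
proof -
  have "of_nat (Suc n) powr (- of_real x) = complex_of_real (real (Suc n) powr (-x))" for n
    by (metis of_nat_0_le_iff of_real_minus of_real_of_nat_eq powr_of_real)
  thus ?thesis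
    unfolding zeta_series_def by (simp only: suminf_of_real[OF summable_nat_powr[OF assms]])
qed

lemma zeta_series_real_pos:
  assumes "x > 1"
  shows "Re (zeta_series (of_real x)) > 0"
  unfolding zeta_series_of_real[OF assms] Re_complex_of_real
  by (rule suminf_pos[OF summable_nat_powr[OF assms]]) simp

section \<open>Functions with nonnegative Taylor coefficients\<close>

definition nonneg_taylor :: "complex \<Rightarrow> real \<Rightarrow> (complex \<Rightarrow> complex) \<Rightarrow> bool" where
  "nonneg_taylor c r f \<longleftrightarrow> 0 < r \<and> f holomorphic_on ball c r \<and> (\<forall>n. (deriv ^^ n) f c \<in> \<real>\<^sub>\<ge>\<^sub>0)"

lemma nonneg_taylor_center: "nonneg_taylor c r f \<Longrightarrow> f c \<in> \<real>\<^sub>\<ge>\<^sub>0"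
  unfolding nonneg_taylor_def by (metis funpow_0)

lemma nonneg_taylor_subset: "nonneg_taylor c r f \<Longrightarrow> 0 < r' \<Longrightarrow> r' \<le> r \<Longrightarrow> nonneg_taylor c r' f"
  unfolding nonneg_taylor_def using holomorphic_on_subset subset_ball by blast

lemma nonneg_taylor_const: "0 < r \<Longrightarrow> a \<in> \<real>\<^sub>\<ge>\<^sub>0 \<Longrightarrow> nonneg_taylor c r (\<lambda>_. a)"
  by (simp add: nonneg_taylor_def)

lemma nonneg_taylor_add:
  assumes "nonneg_taylor c r f" "nonneg_taylor c r g"
  shows "nonneg_taylor c r (\<lambda>s. f s + g s)"
  using assms higher_deriv_add[of f "ball c r" g c]
  by (auto simp: nonneg_taylor_def intro!: holomorphic_intros nonneg_Reals_add_I)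

lemma nonneg_taylor_sum:
  assumes "0 < r" "\<And>i. i \<in> I \<Longrightarrow> nonneg_taylor c r (f i)"
  shows "nonneg_taylor c r (\<lambda>s. \<Sum>i\<in>I. f i s)"
  using assms(2) by (induction I rule: infinite_finite_induct)
    (auto simp: nonneg_taylor_const nonneg_taylor_add assms(1))

lemma nonneg_taylor_mult:
  assumes "nonneg_taylor c r f" "nonneg_taylor c r g"
  shows "nonneg_taylor c r (\<lambda>s. f s * g s)"
proof -
  have "(\<Sum>i\<in>A. of_nat (n choose i) * (deriv ^^ i) f c * (deriv ^^ (n - i)) g c) \<in> \<real>\<^sub>\<ge>\<^sub>0" for n A
    using assms by (induction A rule: infinite_finite_induct)
      (auto simp: nonneg_taylor_def intro!: nonneg_Reals_add_I nonneg_Reals_mult_I)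
  thus ?thesis
    using assms higher_deriv_mult[of f "ball c r" g c]
    by (auto simp: nonneg_taylor_def intro!: holomorphic_intros)
qed

lemma nonneg_taylor_deriv:
  assumes "nonneg_taylor c r f"
  shows "nonneg_taylor c r (deriv f)"
proof -
  have "(deriv ^^ n) (deriv f) = (deriv ^^ Suc n) f" for n
    by (simp add: funpow_swap1)
  thus ?thesis
    using assms unfolding nonneg_taylor_def by (metis holomorphic_deriv open_ball)
qed

lemma nonneg_taylor_uniform_limit:
  assumes f: "\<And>N. nonneg_taylor c \<rho> (f N)" and lim: "uniform_limit (ball c \<rho>) f g sequentially"
    and "0 < r" "g holomorphic_on ball c r"
  shows "nonneg_taylor c r g"
proof -
  have lim: "(\<lambda>N. (deriv ^^ n) (f N) c) \<longlonglongrightarrow> (deriv ^^ n) g c" for n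
    using f by (intro higher_deriv_complex_uniform_limit[OF lim]) (auto simp: nonneg_taylor_def)
  have "(deriv ^^ n) (f N) c \<in> \<real>\<^sub>\<ge>\<^sub>0" for n N
    using f by (simp add: nonneg_taylor_def)
  hence "(deriv ^^ n) g c \<in> \<real>\<^sub>\<ge>\<^sub>0" for n
    by (rule closed_sequentially[OF closed_nonneg_Reals_complex _ lim])
  thus ?thesis using assms by (simp add: nonneg_taylor_def)
qed

lemma nonneg_taylor_sums:
  assumes "nonneg_taylor c r f" "\<bar>x\<bar> < r"
  shows "(\<lambda>n. of_real (Re ((deriv ^^ n) f c) / fact n * x ^ n)) sums f (c + of_real x)"
proof -
  have real: "(deriv ^^ n) f c = of_real (Re ((deriv ^^ n) f c))" for n
    using assms(1) by (auto simp: nonneg_taylor_def complex_nonneg_Reals_iff complex_eq_iff)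
  have "(\<lambda>n. (deriv ^^ n) f c / fact n * (c + of_real x - c) ^ n) sums f (c + of_real x)"
    using assms by (intro holomorphic_power_series[of f c r]) (auto simp: nonneg_taylor_def dist_norm)
  also have "(\<lambda>n. (deriv ^^ n) f c / fact n * (c + of_real x - c) ^ n) =
      (\<lambda>n. of_real (Re ((deriv ^^ n) f c) / fact n * x ^ n))"
    by (subst real) simp
  finally show ?thesis .
qed

lemma nonneg_taylor_Re_sums:
  assumes "nonneg_taylor c r f" "\<bar>x\<bar> < r"
  shows "(\<lambda>n. Re ((deriv ^^ n) f c) / fact n * x ^ n) sums Re (f (c + of_real x))"
  using sums_Re[OF nonneg_taylor_sums[OF assms]] unfolding Re_complex_of_real .

lemma nonneg_taylor_real:
  assumes "nonneg_taylor c r f" "\<bar>x\<bar> < r"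
  shows "f (c + of_real x) \<in> \<real>"
proof -
  have "(\<lambda>_. 0) sums Im (f (c + of_real x))"
    using sums_Im[OF nonneg_taylor_sums[OF assms]] unfolding Im_complex_of_real .
  thus ?thesis by (simp add: complex_is_Real_iff sums_iff)
qed

lemma nonneg_taylor_mono:
  assumes f: "nonneg_taylor c r f" and "0 \<le> x" "x \<le> y" "y < r"
  shows "Re (f (c + of_real x)) \<le> Re (f (c + of_real y))"
proof (rule sums_le[OF _ nonneg_taylor_Re_sums[OF f] nonneg_taylor_Re_sums[OF f]])
  show "Re ((deriv ^^ n) f c) / fact n * x ^ n \<le> Re ((deriv ^^ n) f c) / fact n * y ^ n" for n
    using assms by (intro mult_left_mono power_mono) (auto simp: nonneg_taylor_def complex_nonneg_Reals_iff)
qed (use assms in auto)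

lemma nonneg_taylor_term_le:
  assumes f: "nonneg_taylor c r f" and x: "0 \<le> x" "x < r"
  shows "Re ((deriv ^^ n) f c) / fact n * x ^ n \<le> Re (f (c + of_real x))"
proof -
  have "0 \<le> Re ((deriv ^^ i) f c) / fact i * x ^ i" for i
    using assms by (auto simp: nonneg_taylor_def complex_nonneg_Reals_iff)
  thus ?thesis
    using sum_le_suminf[of "\<lambda>n. Re ((deriv ^^ n) f c) / fact n * x ^ n" "{n}"]
      nonneg_taylor_Re_sums[OF f, of x] x by (simp add: sums_iff)
qed

lemma higher_deriv_exp_centered:
  "(deriv ^^ n) (\<lambda>s. exp (b * (s - c))) c = (b ^ n :: complex)"
proof -
  have "deriv exp = (exp :: complex \<Rightarrow> complex)"
    by (auto intro!: DERIV_imp_deriv)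
  hence "(deriv ^^ n) exp = (exp :: complex \<Rightarrow> complex)"
    by (induction n) auto
  thus ?thesis
    using higher_deriv_compose_linear'[of exp UNIV UNIV c b "- b * c" n]
    by (simp add: holomorphic_on_exp algebra_simps)
qed

lemma nonneg_taylor_exp_pair:
  assumes "0 < r"
  shows "nonneg_taylor c r (\<lambda>s. exp (of_real a * (s - c)) + exp (- of_real a * (s - c)))"
proof -
  have hol: "(\<lambda>s. exp (b * (s - c))) holomorphic_on UNIV" for b
    by (intro holomorphic_intros)
  have "(deriv ^^ n) (\<lambda>s. exp (of_real a * (s - c)) + exp (- of_real a * (s - c))) c =
      of_real (a ^ n + (- a) ^ n)" for n
    unfolding higher_deriv_add[OF hol hol open_UNIV UNIV_I] higher_deriv_exp_centered by simp
  moreover have "0 \<le> a ^ n + (- a) ^ n" for n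
    by (cases "even n") (auto simp: zero_le_even_power)
  ultimately have "(deriv ^^ n) (\<lambda>s. exp (of_real a * (s - c)) + exp (- of_real a * (s - c))) c \<in> \<real>\<^sub>\<ge>\<^sub>0"
    for n by (simp only: nonneg_Reals_of_real_iff)
  thus ?thesis
    using assms unfolding nonneg_taylor_def by (intro conjI allI holomorphic_intros)
qed

section \<open>Symmetrization about a point\<close>

definition reflect_mult :: "complex \<Rightarrow> (complex \<Rightarrow> complex) \<Rightarrow> complex \<Rightarrow> complex" where
  "reflect_mult c f s = f s * f (2 * c - s)"

definition reflect_diff :: "complex \<Rightarrow> (complex \<Rightarrow> complex) \<Rightarrow> complex \<Rightarrow> complex" where
  "reflect_diff c f s = f s - f (2 * c - s)"

lemma reflect_mult_half: "reflect_mult (a / 2) f s = f s * f (a - s)"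
  by (simp add: reflect_mult_def)

lemma reflect_mult_reflect: "reflect_mult c f (2 * c - s) = reflect_mult c f s"
  by (simp add: reflect_mult_def mult.commute)

lemma reflect_diff_reflect: "reflect_diff c f (2 * c - s) = - reflect_diff c f s"
  by (simp add: reflect_diff_def)

lemma dist_reflect: "dist c (2 * c - s) = dist c s" for c s :: complex
  by (simp add: dist_norm norm_minus_commute)

lemma Re_gt_in_ball:
  assumes "s \<in> ball c r"
  shows "Re c - r < Re s" and "Re c - r < Re (2 * c - s)"
  using assms Re_minus_dist_le[of c s] Re_minus_dist_le[of c "2 * c - s"] by (simp_all add: dist_reflect)

lemma holomorphic_on_reflect:
  assumes "f holomorphic_on ball c r"
  shows "(\<lambda>s. f (2 * c - s)) holomorphic_on ball c r"
  by (rule holomorphic_on_compose[of "\<lambda>s. 2 * c - s" _ f, unfolded o_def])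
    (auto simp: dist_reflect intro!: holomorphic_intros holomorphic_on_subset[OF assms])

lemma holomorphic_reflect_mult:
  "f holomorphic_on ball c r \<Longrightarrow> reflect_mult c f holomorphic_on ball c r"
  unfolding reflect_mult_def by (intro holomorphic_on_mult holomorphic_on_reflect)

lemma holomorphic_reflect_diff:
  "f holomorphic_on ball c r \<Longrightarrow> reflect_diff c f holomorphic_on ball c r"
  unfolding reflect_diff_def by (intro holomorphic_on_diff holomorphic_on_reflect)

lemma higher_deriv_reflect_diff:
  assumes f: "f holomorphic_on ball c r" and "0 < r"
  shows "(deriv ^^ n) (reflect_diff c f) c = (1 - (-1) ^ n) * (deriv ^^ n) f c"
proof -
  have "(deriv ^^ n) (\<lambda>s. f (-1 * s + 2 * c)) c = (-1) ^ n * (deriv ^^ n) f (-1 * c + 2 * c)"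
    using \<open>0 < r\<close> dist_reflect[of c]
    by (intro higher_deriv_compose_linear'[OF f open_ball open_ball]) auto
  hence "(deriv ^^ n) (\<lambda>s. f (2 * c - s)) c = (-1) ^ n * (deriv ^^ n) f c"
    by simp
  moreover have "(deriv ^^ n) (reflect_diff c f) c = (deriv ^^ n) f c - (deriv ^^ n) (\<lambda>s. f (2 * c - s)) c"
    unfolding reflect_diff_def
    using \<open>0 < r\<close> by (intro higher_deriv_diff[OF f holomorphic_on_reflect[OF f]]) auto
  ultimately show ?thesis by (simp add: algebra_simps)
qed

lemma holomorphic_Digamma_ball: "Digamma holomorphic_on ball (of_real c) c"
proof (intro holomorphic_on_Polygamma equalityI subsetI)
  fix s :: complex assume "s \<in> ball (of_real c) c \<inter> \<int>\<^sub>\<le>\<^sub>0"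
  thus "s \<in> {}"
    using Re_gt_in_ball(1)[of s "of_real c" c] Re_pos_not_nonpos_Ints[of s] by auto
qed simp

lemma higher_deriv_reflect_diff_Digamma:
  fixes c :: real
  assumes c: "0 < c"
  shows "(deriv ^^ n) (reflect_diff (of_real c) Digamma) (of_real c)
    = of_real ((1 - (-1) ^ n) * Polygamma n c)"
proof -
  have "of_real c \<notin> (\<int>\<^sub>\<le>\<^sub>0 :: complex set)"
    using c by (intro Re_pos_not_nonpos_Ints) simp
  hence "(deriv ^^ n) Digamma (of_real c) = complex_of_real (Polygamma n c)"
    using c higher_deriv_Polygamma[of "complex_of_real c" n 0] by (simp add: Polygamma_of_real)
  thus ?thesis
    using higher_deriv_reflect_diff[OF holomorphic_Digamma_ball c, of n] by simp
qed

lemma nonneg_taylor_reflect_diff_Digamma: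
  fixes c :: real
  assumes c: "0 < c"
  shows "nonneg_taylor (of_real c) c (reflect_diff (of_real c) Digamma)"
proof -
  have "c \<notin> \<int>\<^sub>\<le>\<^sub>0" using c by (auto elim!: nonpos_Ints_cases)
  hence "0 \<le> (1 - (-1) ^ n) * Polygamma n c" for n
    using Polygamma_real_odd_pos[of c n] by (cases "even n") (auto intro: less_imp_le)
  hence "(deriv ^^ n) (reflect_diff (of_real c) Digamma) (of_real c) \<in> \<real>\<^sub>\<ge>\<^sub>0" for n
    by (simp only: higher_deriv_reflect_diff_Digamma[OF c] nonneg_Reals_of_real_iff)
  thus ?thesis
    using c holomorphic_reflect_diff[OF holomorphic_Digamma_ball] unfolding nonneg_taylor_def by blast
qed

lemma deriv_reflect_diff_Digamma_pos:
  fixes c :: real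
  assumes "0 < c"
  shows "0 < Re (deriv (reflect_diff (of_real c) Digamma) (of_real c))"
proof -
  have "c \<notin> \<int>\<^sub>\<le>\<^sub>0" using assms by (auto elim!: nonpos_Ints_cases)
  thus ?thesis
    using arg_cong[OF higher_deriv_reflect_diff_Digamma[OF assms, of 1], of Re] Polygamma_real_odd_pos[of c 1]
    by simp
qed

text \<open>Pairing the terms \<open>(i, j)\<close> and \<open>(j, i)\<close> of the product turns it into a nonnegative
  combination of hyperbolic cosines centred at \<open>c\<close>.\<close>

lemma nonneg_taylor_reflect_mult_exp_sum:
  fixes l :: "'i \<Rightarrow> real" and c :: real
  assumes "0 < r"
  shows "nonneg_taylor (of_real c) r (reflect_mult (of_real c) (\<lambda>s. \<Sum>i\<in>I. exp (- of_real (l i) * s)))"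
proof -
  define E where "E = (\<lambda>i (s :: complex). exp (- of_real (l i) * s))"
  define w where "w = (\<lambda>i j. exp (- (l i + l j) * c) / 2)"
  define pair where "pair = (\<lambda>i j (s :: complex).
    exp (of_real (l j - l i) * (s - of_real c)) + exp (- of_real (l j - l i) * (s - of_real c)))"
  have pair: "E i s * E j (2 * of_real c - s) + E j s * E i (2 * of_real c - s) =
      2 * (of_real (w i j) * pair i j s)" for i j s
    by (simp add: E_def w_def pair_def exp_of_real[symmetric] exp_add[symmetric] algebra_simps)
  have "2 * reflect_mult (of_real c) (\<lambda>s. \<Sum>i\<in>I. E i s) s =
      (\<Sum>i\<in>I. \<Sum>j\<in>I. E i s * E j (2 * of_real c - s)) +
      (\<Sum>i\<in>I. \<Sum>j\<in>I. E j s * E i (2 * of_real c - s))" for s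
    by (subst (2) sum.swap) (simp add: reflect_mult_def sum_product)
  also have "\<dots> s = 2 * (\<Sum>i\<in>I. \<Sum>j\<in>I. of_real (w i j) * pair i j s)" for s
    unfolding sum.distrib[symmetric] pair sum_distrib_left ..
  finally have cosh_sum: "reflect_mult (of_real c) (\<lambda>s. \<Sum>i\<in>I. E i s) =
      (\<lambda>s. \<Sum>i\<in>I. \<Sum>j\<in>I. of_real (w i j) * pair i j s)"
    by (simp add: fun_eq_iff)
  have "nonneg_taylor (of_real c) r (reflect_mult (of_real c) (\<lambda>s. \<Sum>i\<in>I. E i s))"
    unfolding cosh_sum pair_def using assms
    by (intro nonneg_taylor_sum nonneg_taylor_mult nonneg_taylor_const nonneg_taylor_exp_pair)
      (simp_all add: w_def)
  thus ?thesis by (simp only: E_def)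
qed

lemma uniform_limit_reflect_mult_zeta:
  fixes c d :: real
  assumes "1 < c - d"
  shows "uniform_limit (ball (of_real c) d) (\<lambda>N. reflect_mult (of_real c) (zeta_partial N))
    (reflect_mult (of_real c) zeta_series) sequentially"
proof -
  let ?B = "cball (complex_of_real c) d"
  have Re: "c - d \<le> Re s" "c - d \<le> Re (2 * of_real c - s)" if "s \<in> ?B" for s
    using that Re_minus_dist_le[of "of_real c" s] Re_minus_dist_le[of "of_real c" "2 * of_real c - s"]
    by (auto simp: dist_reflect)
  have lim: "uniform_limit ?B zeta_partial zeta_series sequentially"
    by (rule uniform_limit_on_subset[OF uniform_limit_zeta_partial[OF assms]]) (use Re in auto)
  have lim_reflect: "uniform_limit ?B (\<lambda>N s. zeta_partial N (2 * of_real c - s))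
      (\<lambda>s. zeta_series (2 * of_real c - s)) sequentially"
    by (rule uniform_limit_compose'[OF uniform_limit_zeta_partial[OF assms]]) (use Re in auto)
  have "continuous_on ?B zeta_series" "continuous_on ?B (\<lambda>s. zeta_series (2 * of_real c - s))"
    using Re assms by (auto intro!: holomorphic_on_imp_continuous_on holomorphic_intros intro: less_le_trans)
  hence "bounded (zeta_series ` ?B)" "bounded ((\<lambda>s. zeta_series (2 * of_real c - s)) ` ?B)"
    by (auto intro!: compact_imp_bounded compact_continuous_image)
  from uniform_lim_mult[OF lim lim_reflect this] show ?thesis
    unfolding reflect_mult_def by (rule uniform_limit_on_subset) auto
qed

lemma nonneg_taylor_reflect_mult_zeta:
  fixes c :: real
  assumes "1 < c"
  shows "nonneg_taylor (of_real c) (c - 1) (reflect_mult (of_real c) zeta_series)"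
proof (rule nonneg_taylor_uniform_limit)
  define d where "d = (c - 1) / 2"
  have "0 < d" "1 < c - d" using assms by (simp_all add: d_def field_simps)
  show "uniform_limit (ball (of_real c) d) (\<lambda>N. reflect_mult (of_real c) (zeta_partial N))
      (reflect_mult (of_real c) zeta_series) sequentially"
    by (rule uniform_limit_reflect_mult_zeta[OF \<open>1 < c - d\<close>])
  have "of_nat (Suc n) powr (-s) = exp (- of_real (ln (real (Suc n))) * s)" for n and s :: complex
    by (simp add: powr_def Ln_of_nat mult.commute del: of_nat_Suc)
  thus "nonneg_taylor (of_real c) d (reflect_mult (of_real c) (zeta_partial N))" for N
    by (simp only: zeta_partial_def[abs_def] nonneg_taylor_reflect_mult_exp_sum[OF \<open>0 < d\<close>])
  have "zeta_series holomorphic_on ball (of_real c) (c - 1)"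
    using Re_gt_in_ball(1)[of _ "of_real c" "c - 1"]
    by (intro holomorphic_on_subset[OF holomorphic_zeta_series]) fastforce
  thus "reflect_mult (of_real c) zeta_series holomorphic_on ball (of_real c) (c - 1)"
    by (rule holomorphic_reflect_mult)
qed (use assms in simp)

section \<open>The twisted derivative\<close>

primrec twisted_deriv :: "(complex \<Rightarrow> complex) \<Rightarrow> (complex \<Rightarrow> complex) \<Rightarrow> nat \<Rightarrow> complex \<Rightarrow> complex" where
  "twisted_deriv L h 0 = h"
| "twisted_deriv L h (Suc m) = (\<lambda>s. deriv (twisted_deriv L h m) s + L s * twisted_deriv L h m s)"

lemma holomorphic_twisted_deriv:
  assumes "L holomorphic_on S" "h holomorphic_on S" "open S"
  shows "twisted_deriv L h m holomorphic_on S"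
  using assms by (induction m) (auto intro!: holomorphic_intros)

lemma higher_deriv_mult_eq_twisted_deriv:
  assumes "L holomorphic_on S" "h holomorphic_on S" "open S" "s \<in> S"
    and p: "\<And>s. s \<in> S \<Longrightarrow> (p has_field_derivative L s * p s) (at s)"
  shows "(deriv ^^ m) (\<lambda>s. p s * h s) s = p s * twisted_deriv L h m s"
  using \<open>s \<in> S\<close>
proof (induction m arbitrary: s)
  case (Suc m)
  have "(twisted_deriv L h m has_field_derivative deriv (twisted_deriv L h m) s) (at s)"
    using holomorphic_twisted_deriv[OF assms(1-3)] \<open>open S\<close> Suc.prems by (rule holomorphic_derivI)
  from DERIV_mult[OF p[OF Suc.prems] this]
  have "((\<lambda>s. p s * twisted_deriv L h m s) has_field_derivative p s * twisted_deriv L h (Suc m) s) (at s)"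
    by (simp add: algebra_simps)
  hence "((deriv ^^ m) (\<lambda>s. p s * h s) has_field_derivative p s * twisted_deriv L h (Suc m) s) (at s)"
    by (rule has_field_derivative_transform_within_open[OF _ \<open>open S\<close> Suc.prems]) (simp add: Suc.IH)
  thus ?case by (simp add: DERIV_imp_deriv)
qed simp

lemma twisted_deriv_reflect:
  assumes "L holomorphic_on S" "h holomorphic_on S" "open S" "s \<in> S"
    and S: "\<And>s. s \<in> S \<Longrightarrow> 2 * c - s \<in> S"
    and L: "\<And>s. s \<in> S \<Longrightarrow> L (2 * c - s) = - L s" and h: "\<And>s. s \<in> S \<Longrightarrow> h (2 * c - s) = h s"
  shows "twisted_deriv L h m (2 * c - s) = (-1) ^ m * twisted_deriv L h m s"
  using \<open>s \<in> S\<close>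
proof (induction m arbitrary: s)
  case (Suc m)
  let ?T = "twisted_deriv L h m"
  have der: "(?T has_field_derivative deriv ?T s) (at s)" if "s \<in> S" for s
    using holomorphic_twisted_deriv[OF assms(1-3)] \<open>open S\<close> that by (rule holomorphic_derivI)
  have "((\<lambda>s. ?T (2 * c - s)) has_field_derivative deriv ?T (2 * c - s) * (0 - 1)) (at s)"
    by (rule DERIV_chain2[of ?T]) (auto intro!: derivative_eq_intros der S Suc.prems)
  hence "((\<lambda>s. (-1) ^ m * ?T s) has_field_derivative - deriv ?T (2 * c - s)) (at s)"
    unfolding diff_0 mult_minus1_right
    by (rule has_field_derivative_transform_within_open[OF _ \<open>open S\<close> Suc.prems]) (rule Suc.IH)
  moreover have "((\<lambda>s. (-1) ^ m * ?T s) has_field_derivative (-1) ^ m * deriv ?T s) (at s)"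
    by (intro DERIV_cmult der Suc.prems)
  ultimately have "- deriv ?T (2 * c - s) = (-1) ^ m * deriv ?T s"
    by (rule DERIV_unique)
  hence "deriv ?T (2 * c - s) = - ((-1) ^ m * deriv ?T s)"
    by (metis minus_minus)
  thus ?case
    using L[OF Suc.prems] Suc.IH[OF Suc.prems] by (simp add: algebra_simps)
qed (use h in simp)

context
  fixes c :: complex and r :: real and L h :: "complex \<Rightarrow> complex"
  assumes L: "nonneg_taylor c r L" and h: "nonneg_taylor c r h"
begin

lemma nonneg_taylor_twisted_deriv: "nonneg_taylor c r (twisted_deriv L h m)"
  by (induction m) (auto intro!: nonneg_taylor_add nonneg_taylor_mult nonneg_taylor_deriv L h)

text \<open>Only the Taylor coefficient of index 0 or 1 is guaranteed to be positive, by the parity of \<open>m\<close>,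
  but this suffices off the centre.\<close>

lemma twisted_deriv_center_pos:
  assumes pos: "0 < Re (deriv L c)" "0 < Re (h c)"
  shows "if even m then 0 < Re (twisted_deriv L h m c) else 0 < Re (deriv (twisted_deriv L h m) c)"
proof (induction m)
  case (Suc m)
  let ?T = "twisted_deriv L h m"
  note T = nonneg_taylor_twisted_deriv[of m]
  have nonneg: "0 \<le> Re (f c)" "Im (f c) = 0" if "nonneg_taylor c r f" for f
    using nonneg_taylor_center[OF that] by (auto simp: complex_nonneg_Reals_iff)
  show ?case
  proof (cases "even m")
    case True
    have der: "(f has_field_derivative deriv f c) (at c)" if "nonneg_taylor c r f" for f
      using that unfolding nonneg_taylor_def by (intro holomorphic_derivI[of _ "ball c r"]) auto
    have "deriv (twisted_deriv L h (Suc m)) c = deriv (deriv ?T) c + (deriv L c * ?T c + deriv ?T c * L c)"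
      unfolding twisted_deriv.simps
      by (intro DERIV_imp_deriv DERIV_add DERIV_mult der nonneg_taylor_deriv T L)
    moreover have "0 < Re (deriv L c * ?T c)"
      using True Suc.IH pos(1) nonneg[OF T] by simp
    ultimately show ?thesis
      using True nonneg[OF L] nonneg[OF nonneg_taylor_deriv[OF T]]
        nonneg[OF nonneg_taylor_deriv[OF nonneg_taylor_deriv[OF T]]]
      by (simp add: add_nonneg_pos add_pos_nonneg)
  next
    case False
    thus ?thesis
      using Suc.IH nonneg[OF L] nonneg[OF T] by (simp add: add_pos_nonneg)
  qed
qed (use pos in simp)

lemma twisted_deriv_pos:
  assumes pos: "0 < Re (deriv L c)" "0 < Re (h c)" and x: "0 \<le> x" "x < r" and m: "even m \<or> 0 < x"
  shows "0 < Re (twisted_deriv L h m (c + of_real x))"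
proof (cases "even m")
  case True
  thus ?thesis
    using twisted_deriv_center_pos[OF pos, of m] x
      nonneg_taylor_term_le[OF nonneg_taylor_twisted_deriv x, of 0 m] by simp
next
  case False
  hence "0 < Re (deriv (twisted_deriv L h m) c) * x"
    using twisted_deriv_center_pos[OF pos, of m] m by simp
  thus ?thesis
    using nonneg_taylor_term_le[OF nonneg_taylor_twisted_deriv x, of 1 m] by simp
qed

end

section \<open>Holomorphic Mellin transforms\<close>

lemma norm_exp_partial_sum_le:
  fixes z :: complex
  shows "norm (\<Sum>n<N. z ^ n /\<^sub>R fact n) \<le> exp (norm z)"
proof -
  have "norm (\<Sum>n<N. z ^ n /\<^sub>R fact n) \<le> (\<Sum>n<N. norm z ^ n /\<^sub>R fact n)"
    by (rule order_trans[OF norm_sum]) (simp add: norm_power)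
  also have "\<dots> \<le> exp (norm z)"
    unfolding exp_def by (intro sum_le_suminf summable_exp_generic) auto
  finally show ?thesis .
qed

lemma exp_abs_le: "exp \<bar>t\<bar> \<le> exp t + exp (- t :: real)"
  by (cases "t \<ge> 0") auto

lemma sums_integral_dominated:
  fixes f :: "nat \<Rightarrow> 'a \<Rightarrow> 'b :: {banach, second_countable_topology}"
  assumes [measurable]: "\<And>n. f n \<in> borel_measurable M" "F \<in> borel_measurable M"
    and int_B: "integrable M B" and le_B: "\<And>N x. norm (\<Sum>n<N. f n x) \<le> B x"
    and sums: "\<And>x. (\<lambda>n. f n x) sums F x"
  shows "(\<lambda>n. integral\<^sup>L M (f n)) sums integral\<^sup>L M F"
proof -
  have "norm (f n x) \<le> norm (2 * B x)" for n x
  proof -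
    have "f n x = (\<Sum>i<Suc n. f i x) - (\<Sum>i<n. f i x)" by simp
    thus ?thesis
      using norm_triangle_ineq4[of "\<Sum>i<Suc n. f i x" "\<Sum>i<n. f i x"]
        le_B[where N = "Suc n" and x = x] le_B[where N = n and x = x] by simp
  qed
  hence int: "integrable M (f n)" for n
    using Bochner_Integration.integrable_bound[of M "\<lambda>x. 2 * B x" "f n"] int_B by simp
  have "(\<lambda>N. \<integral>x. (\<Sum>n<N. f n x) \<partial>M) \<longlonglongrightarrow> integral\<^sup>L M F"
  proof (rule integral_dominated_convergence[OF _ _ int_B])
    show "AE x in M. (\<lambda>N. \<Sum>n<N. f n x) \<longlonglongrightarrow> F x"
      using sums by (simp add: sums_def)
    show "AE x in M. norm (\<Sum>n<N. f n x) \<le> B x" for N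
      using le_B by simp
  qed measurable
  thus ?thesis
    by (simp add: sums_def Bochner_Integration.integral_sum int)
qed

lemma sums_integral_exp:
  fixes M :: "'a measure" and g l :: "'a \<Rightarrow> real"
  assumes [measurable]: "g \<in> borel_measurable M" "l \<in> borel_measurable M"
    and int: "\<And>\<sigma>. \<bar>\<sigma> - Re s\<bar> \<le> norm (w - s) \<Longrightarrow> integrable M (\<lambda>x. g x * exp (\<sigma> * l x))"
  shows "(\<lambda>n. (\<integral>x. of_real (g x) * exp (s * of_real (l x)) * of_real (l x) ^ n / fact n \<partial>M) * (w - s) ^ n)
    sums (\<integral>x. of_real (g x) * exp (w * of_real (l x)) \<partial>M)"
proof -
  define \<rho> where "\<rho> = norm (w - s)"
  define z where "z = (\<lambda>x. (w - s) * of_real (l x))"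
  define a where "a = (\<lambda>x. of_real (g x) * exp (s * of_real (l x)))"
  define B where "B = (\<lambda>x. \<bar>g x * exp ((Re s + \<rho>) * l x)\<bar> + \<bar>g x * exp ((Re s - \<rho>) * l x)\<bar>)"
  have "(\<lambda>n. \<integral>x. a x * (z x ^ n /\<^sub>R fact n) \<partial>M) sums (\<integral>x. of_real (g x) * exp (w * of_real (l x)) \<partial>M)"
  proof (rule sums_integral_dominated)
    show "integrable M B"
      unfolding B_def by (intro Bochner_Integration.integrable_add integrable_abs int) (simp_all add: \<rho>_def)
    show "norm (\<Sum>n<N. a x * (z x ^ n /\<^sub>R fact n)) \<le> B x" for N x
    proof -
      have "norm (\<Sum>n<N. a x * (z x ^ n /\<^sub>R fact n)) \<le> norm (a x) * exp (norm (z x))"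
        unfolding sum_distrib_left[symmetric] norm_mult
        by (intro mult_left_mono norm_exp_partial_sum_le) auto
      also have "\<dots> \<le> norm (a x) * (exp (\<rho> * l x) + exp (- (\<rho> * l x)))"
        using exp_abs_le[of "\<rho> * l x"] by (intro mult_left_mono) (auto simp: z_def \<rho>_def norm_mult abs_mult)
      also have "\<dots> = B x"
        by (simp add: a_def B_def norm_mult abs_mult algebra_simps exp_add exp_diff exp_minus divide_inverse)
      finally show ?thesis .
    qed
    have "a x * exp (z x) = of_real (g x) * exp (w * of_real (l x))" for x
      by (simp add: a_def z_def exp_add[symmetric] algebra_simps)
    thus "(\<lambda>n. a x * (z x ^ n /\<^sub>R fact n)) sums (of_real (g x) * exp (w * of_real (l x)))" for x
      using sums_mult[OF exp_converges[of "z x"], of "a x"] by simp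
  qed (unfold a_def z_def, measurable)
  moreover have "(\<integral>x. a x * (z x ^ n /\<^sub>R fact n) \<partial>M) =
      (\<integral>x. of_real (g x) * exp (s * of_real (l x)) * of_real (l x) ^ n / fact n \<partial>M) * (w - s) ^ n" for n
    unfolding integral_mult_left_zero[symmetric]
    by (simp add: a_def z_def power_mult_distrib scaleR_conv_of_real divide_inverse mult_ac)
  ultimately show ?thesis by simp
qed

lemma holomorphic_integral_exp:
  fixes M :: "'a measure" and g l :: "'a \<Rightarrow> real"
  assumes meas: "g \<in> borel_measurable M" "l \<in> borel_measurable M"
    and "open U" and int: "\<And>\<sigma>. \<sigma> \<in> U \<Longrightarrow> integrable M (\<lambda>x. g x * exp (\<sigma> * l x))"
  shows "(\<lambda>s. \<integral>x. of_real (g x) * exp (s * of_real (l x)) \<partial>M) holomorphic_on {s. Re s \<in> U}"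
    (is "?F holomorphic_on _")
proof -
  have "?F field_differentiable (at s within {s. Re s \<in> U})" if s: "Re s \<in> U" for s
  proof -
    obtain r where r: "r > 0" "cball (Re s) r \<subseteq> U"
      using \<open>open U\<close> s open_contains_cball by blast
    have "?F holomorphic_on ball s r"
    proof (rule power_series_holomorphic, rule sums_integral_exp[OF meas])
      fix w \<sigma> assume "w \<in> ball s r" "\<bar>\<sigma> - Re s\<bar> \<le> norm (w - s)"
      hence "\<sigma> \<in> cball (Re s) r"
        by (auto simp: dist_norm norm_minus_commute abs_minus_commute)
      with r show "integrable M (\<lambda>x. g x * exp (\<sigma> * l x))" by (intro int) auto
    qed
    with r show ?thesis
      by (meson centre_in_ball field_differentiable_at_within holomorphic_on_imp_differentiable_at open_ball)
  qed
  thus ?thesis by (simp add: holomorphic_on_def)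
qed

definition mellin_on :: "real set \<Rightarrow> (real \<Rightarrow> real) \<Rightarrow> complex \<Rightarrow> complex" where
  "mellin_on S g s = (\<integral>x. of_real (g x) * of_real x powr (s - 1) \<partial>lebesgue_on S)"

lemma borel_measurable_lebesgue_on: "f \<in> borel_measurable borel \<Longrightarrow> f \<in> borel_measurable (lebesgue_on S)"
  by (intro measurable_restrict_space1 measurable_completion) simp

lemma holomorphic_mellin_on:
  fixes g :: "real \<Rightarrow> real"
  assumes S: "S \<subseteq> {0<..}" and [measurable]: "g \<in> borel_measurable borel" and "open U"
    and int: "\<And>\<sigma>. \<sigma> \<in> U \<Longrightarrow> integrable (lebesgue_on S) (\<lambda>x. g x * x powr (\<sigma> - 1))"
  shows "mellin_on S g holomorphic_on {s. Re s \<in> U}"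
proof -
  have "(\<lambda>s. \<integral>x. of_real (g x / x) * exp (s * of_real (ln x)) \<partial>lebesgue_on S) holomorphic_on {s. Re s \<in> U}"
  proof (rule holomorphic_integral_exp[OF _ _ \<open>open U\<close>])
    fix \<sigma> assume "\<sigma> \<in> U"
    have "g x * x powr (\<sigma> - 1) = g x / x * exp (\<sigma> * ln x)" if "x \<in> S" for x
      using that S by (auto simp: powr_def exp_diff left_diff_distrib)
    thus "integrable (lebesgue_on S) (\<lambda>x. g x / x * exp (\<sigma> * ln x))"
      using int[OF \<open>\<sigma> \<in> U\<close>] by (subst Bochner_Integration.integrable_cong[OF refl]) auto
  qed (rule borel_measurable_lebesgue_on, measurable)+
  moreover have "mellin_on S g = (\<lambda>s. \<integral>x. of_real (g x / x) * exp (s * of_real (ln x)) \<partial>lebesgue_on S)"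
    unfolding mellin_on_def
    using S by (intro ext Bochner_Integration.integral_cong)
      (auto simp: powr_def exp_diff left_diff_distrib Ln_of_real)
  ultimately show ?thesis by simp
qed

lemma mellin_on_of_real:
  fixes g :: "real \<Rightarrow> real"
  assumes "S \<subseteq> {0<..}"
  shows "mellin_on S g (of_real s) = of_real (\<integral>x. g x * x powr (s - 1) \<partial>lebesgue_on S)"
proof -
  have "mellin_on S g (of_real s) = (\<integral>x. of_real (g x * x powr (s - 1)) \<partial>lebesgue_on S)"
    unfolding mellin_on_def
    using assms by (intro Bochner_Integration.integral_cong) (auto simp: powr_Reals_eq)
  thus ?thesis by (simp only: integral_complex_of_real)
qed

lemma has_integral_mellin_on:
  fixes g :: "real \<Rightarrow> real"
  assumes "S \<in> sets lebesgue" "S \<subseteq> {0<..}" "integrable (lebesgue_on S) (\<lambda>x. g x * x powr (s - 1))"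
  shows "((\<lambda>x. g x * x powr (s - 1)) has_integral Re (mellin_on S g (of_real s))) S"
  unfolding mellin_on_of_real[OF assms(2)] Re_complex_of_real
  by (rule has_integral_integral_lebesgue_on[OF assms(3,1)])

lemma integrable_mellin_if_has_integral:
  fixes g :: "real \<Rightarrow> real"
  assumes S: "S \<in> sets lebesgue" "S \<subseteq> {0<..}" and [measurable]: "g \<in> borel_measurable borel"
    and int: "((\<lambda>x. g x * x powr (t - 1)) has_integral I) {0<..}"
    and nonneg: "\<And>x. 0 < x \<Longrightarrow> 0 \<le> g x" and le: "\<And>x. x \<in> S \<Longrightarrow> x powr (s - 1) \<le> x powr (t - 1)"
  shows "integrable (lebesgue_on S) (\<lambda>x. g x * x powr (s - 1))"
proof (rule Bochner_Integration.integrable_bound)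
  have "(\<lambda>x. g x * x powr (t - 1)) absolutely_integrable_on {0<..}"
    using int nonneg by (intro nonnegative_absolutely_integrable_1) (auto simp: has_integral_iff)
  hence "(\<lambda>x. g x * x powr (t - 1)) absolutely_integrable_on S"
    using S by (rule set_integrable_subset)
  thus "integrable (lebesgue_on S) (\<lambda>x. g x * x powr (t - 1))"
    using S(1) by (rule absolutely_integrable_imp_integrable)
  show "(\<lambda>x. g x * x powr (s - 1)) \<in> borel_measurable (lebesgue_on S)"
    by (rule borel_measurable_lebesgue_on) measurable
  show "AE x in lebesgue_on S. norm (g x * x powr (s - 1)) \<le> norm (g x * x powr (t - 1))"
    using nonneg le S(2) by (intro AE_I2) (auto simp: abs_mult intro!: mult_left_mono)
qed

section \<open>Integrals over the positive axis\<close>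

lemma has_integral_sums_nonneg:
  fixes f :: "nat \<Rightarrow> 'a :: euclidean_space \<Rightarrow> real"
  assumes "\<And>n. (f n has_integral c n) S" "\<And>n x. x \<in> S \<Longrightarrow> 0 \<le> f n x"
    and "\<And>x. x \<in> S \<Longrightarrow> (\<lambda>n. f n x) sums g x" "c sums C"
  shows "(g has_integral C) S"
  by (rule has_integral_monotone_convergence_increasing[where f = "\<lambda>N x. \<Sum>n<N. f n x"
        and x = "\<lambda>N. \<Sum>n<N. c n"])
     (use assms in \<open>auto simp: sums_def intro!: has_integral_sum\<close>)

lemma has_integral_change_of_variables_nonneg:
  fixes f g g' :: "real \<Rightarrow> real"
  assumes "S \<in> sets lebesgue" "\<And>x. x \<in> S \<Longrightarrow> (g has_field_derivative g' x) (at x within S)"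
    and g: "bij_betw g S T" and "\<And>x. x \<in> S \<Longrightarrow> 0 \<le> g' x"
    and "(f has_integral I) T" "\<And>y. y \<in> T \<Longrightarrow> 0 \<le> f y"
  shows "((\<lambda>x. g' x * f (g x)) has_integral I) S"
proof -
  have "f absolutely_integrable_on (g ` S)" "integral (g ` S) f = I"
    using assms(5,6) g unfolding bij_betw_def
    by (auto simp: has_integral_iff intro!: nonnegative_absolutely_integrable_1)
  hence "(\<lambda>x. \<bar>g' x\<bar> * f (g x)) absolutely_integrable_on S \<and> integral S (\<lambda>x. \<bar>g' x\<bar> * f (g x)) = I"
    using has_absolute_integral_change_of_variables_1'[OF assms(1,2) bij_betw_imp_inj_on[OF g]] by blast
  hence "((\<lambda>x. \<bar>g' x\<bar> * f (g x)) has_integral I) S"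
    by (auto simp: has_integral_iff absolutely_integrable_on_def)
  thus ?thesis
    by (rule has_integral_eq[rotated]) (use assms(4) in auto)
qed

lemma has_integral_Gamma_scaled:
  assumes "s > 0" "c > (0 :: real)"
  shows "((\<lambda>x. exp (- (c * x)) * x powr (s - 1)) has_integral Gamma s * c powr (-s)) {0<..}"
proof -
  have "((\<lambda>t. t powr (s - 1) / exp t) has_integral Gamma s) {0<..}"
    using Gamma_integral_real[OF assms(1)]
    by (subst (asm) has_integral_spike_set_eq[of _ "{0<..}"]) (auto intro: negligible_subset[of "{0}"])
  moreover have "bij_betw (\<lambda>x. c * x) {0<..} {0<..}"
    by (rule bij_betw_byWitness[where f' = "\<lambda>y. y / c"]) (use assms in auto)
  ultimately have "((\<lambda>x. c * ((c * x) powr (s - 1) / exp (c * x))) has_integral Gamma s) {0<..}"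
    using assms by (intro has_integral_change_of_variables_nonneg[where g' = "\<lambda>_. c"])
      (auto intro!: derivative_eq_intros)
  from has_integral_mult_right[OF this, of "c powr (-s)"]
  have "((\<lambda>x. c powr (-s) * (c * ((c * x) powr (s - 1) / exp (c * x))))
        has_integral Gamma s * c powr (-s)) {0<..}"
    by (simp add: mult.commute)
  thus ?thesis
  proof (rule has_integral_eq[rotated])
    fix x :: real assume "x \<in> {0<..}"
    have "c powr (-s) * (c * c powr (s - 1)) = 1"
      using assms by (simp add: powr_minus powr_diff)
    thus "c powr (-s) * (c * ((c * x) powr (s - 1) / exp (c * x))) = exp (- (c * x)) * x powr (s - 1)"
      using \<open>x \<in> {0<..}\<close> assms by (simp add: powr_mult exp_minus field_simps)
  qed
qed

lemma Beta_one_minus_real: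
  fixes a :: real
  shows "Beta a (1 - a) = pi / sin (pi * a)"
proof -
  have "complex_of_real (Beta a (1 - a)) = Gamma (of_real a) * Gamma (1 - of_real a)"
    by (simp add: Beta_def Gamma_complex_of_real[symmetric])
  also have "\<dots> = of_real (pi / sin (pi * a))"
    by (simp add: Gamma_reflection_complex sin_of_real[symmetric])
  finally show ?thesis by (simp only: of_real_eq_iff)
qed

lemma has_integral_powr_over_one_plus:
  fixes a :: real
  assumes a: "0 < a" "a < 1"
  shows "((\<lambda>x. x powr (a - 1) / (1 + x)) has_integral pi / sin (pi * a)) {0<..}"
proof -
  have "((\<lambda>t. t powr (a - 1) * (1 - t) powr (- a)) has_integral pi / sin (pi * a)) {0<..<1}"
    using has_integral_Beta_real[of a "1 - a"] a
    by (simp add: has_integral_Icc_iff_Ioo flip: Beta_one_minus_real)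
  moreover have "bij_betw (\<lambda>x. x / (1 + x)) {0<..} {0<..<1 :: real}"
    by (rule bij_betw_byWitness[where f' = "\<lambda>y. y / (1 - y)"]) (auto simp: field_simps)
  moreover have "((\<lambda>x. x / (1 + x)) has_field_derivative 1 / (1 + x) ^ 2) (at x within {0<..})"
    if "x \<in> {0<..}" for x :: real
    using that by (auto intro!: derivative_eq_intros simp: power2_eq_square field_simps)
  ultimately have "((\<lambda>x. 1 / (1 + x) ^ 2 * ((x / (1 + x)) powr (a - 1) * (1 - x / (1 + x)) powr (- a)))
      has_integral pi / sin (pi * a)) {0<..}"
    by (intro has_integral_change_of_variables_nonneg[where g = "\<lambda>x. x / (1 + x)"]) auto
  thus ?thesis
  proof (rule has_integral_eq[rotated])
    fix x :: real assume "x \<in> {0<..}"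
    hence x: "0 < x" by simp
    have "1 - x / (1 + x) = 1 / (1 + x)" "(1 + x) powr a = (1 + x) * (1 + x) powr (a - 1)"
      using x by (simp_all add: field_simps powr_diff)
    thus "1 / (1 + x) ^ 2 * ((x / (1 + x)) powr (a - 1) * (1 - x / (1 + x)) powr (- a))
      = x powr (a - 1) / (1 + x)"
      using x by (simp add: powr_divide powr_minus_divide power2_eq_square)
  qed
qed

lemma has_integral_powr_over_quadratic:
  fixes s A :: real
  assumes s: "-1 < s" "s < 1" and A: "0 < A"
  shows "((\<lambda>x. 2 * x powr s / (x ^ 2 + A ^ 2)) has_integral A powr (s - 1) * (pi / cos (pi * s / 2))) {0<..}"
proof -
  define a where "a = (1 + s) / 2"
  have "sin (pi * a) = cos (pi * s / 2)"
    by (simp add: a_def sin_cos_eq field_simps)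
  hence "((\<lambda>y. y powr (a - 1) / (1 + y)) has_integral pi / cos (pi * s / 2)) {0<..}"
    using has_integral_powr_over_one_plus[of a] s by (simp add: a_def)
  moreover have "bij_betw (\<lambda>x. (x / A) ^ 2) {0<..} {0<..}"
    by (rule bij_betw_byWitness[where f' = "\<lambda>y. A * sqrt y"]) (use A in auto)
  moreover have "((\<lambda>x. (x / A) ^ 2) has_field_derivative 2 * x / A ^ 2) (at x within {0<..})" for x
    using A by (auto intro!: derivative_eq_intros simp: power2_eq_square)
  ultimately have "((\<lambda>x. 2 * x / A ^ 2 * (((x / A) ^ 2) powr (a - 1) / (1 + (x / A) ^ 2)))
      has_integral pi / cos (pi * s / 2)) {0<..}"
    by (intro has_integral_change_of_variables_nonneg[where g = "\<lambda>x. (x / A) ^ 2"]) auto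
  from has_integral_mult_right[OF this, of "A powr (s - 1)"] show ?thesis
  proof (rule has_integral_eq[rotated])
    fix x :: real assume "x \<in> {0<..}"
    hence x: "0 < x" by simp
    have "(y ^ 2) powr (a - 1) = y powr (s - 1)" if "0 < y" for y
    proof -
      have "2 * (a - 1) = s - 1" by (simp add: a_def)
      thus ?thesis using that by (simp add: powr_powr flip: powr_numeral)
    qed
    from this[of "x / A"] have numerator: "A powr (s - 1) * ((x / A) ^ 2) powr (a - 1) * x = x powr s"
      using x A by (simp add: powr_divide powr_diff)
    have denominator: "A ^ 2 * (1 + (x / A) ^ 2) = x ^ 2 + A ^ 2"
      using A by (simp add: field_simps)
    have "A powr (s - 1) * (2 * x / A ^ 2 * (((x / A) ^ 2) powr (a - 1) / (1 + (x / A) ^ 2))) =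
        2 * (A powr (s - 1) * ((x / A) ^ 2) powr (a - 1) * x) / (A ^ 2 * (1 + (x / A) ^ 2))"
      by (simp only: divide_inverse inverse_mult_distrib mult_ac)
    thus "A powr (s - 1) * (2 * x / A ^ 2 * (((x / A) ^ 2) powr (a - 1) / (1 + (x / A) ^ 2))) =
        2 * x powr s / (x ^ 2 + A ^ 2)"
      by (simp only: numerator denominator)
  qed
qed

lemma has_integral_powr_Ioc:
  fixes s :: real
  assumes "0 < s"
  shows "((\<lambda>x. x powr (s - 1)) has_integral 1 / s) {0<..1}"
proof -
  have "((\<lambda>x. x powr (s - 1)) has_integral 1 / s) {0..1}"
    using has_integral_powr_from_0[of "s - 1" 1] assms by simp
  thus ?thesis
    by (subst (asm) has_integral_spike_set_eq[of _ "{0<..1}"]) (auto intro: negligible_subset[of "{0}"])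
qed

lemma has_integral_powr_Ioi:
  fixes s :: real
  assumes "s < 0"
  shows "((\<lambda>x. x powr (s - 1)) has_integral - 1 / s) {1<..}"
proof -
  have "((\<lambda>x. x powr (s - 1)) has_integral - 1 / s) {1..}"
    using has_integral_powr_to_inf[of "s - 1" 1] assms by simp
  thus ?thesis
    by (subst (asm) has_integral_spike_set_eq[of _ "{1<..}"]) (auto intro: negligible_subset[of "{1}"])
qed

lemma has_integral_Ioc_Ioi:
  fixes f :: "real \<Rightarrow> real"
  assumes "(f has_integral a) {0<..1}" "(f has_integral b) {1<..}"
  shows "(f has_integral a + b) {0<..}"
proof -
  have "(f has_integral a + b) ({0<..1} \<union> {1<..})"
    using assms by (rule has_integral_Un) (auto simp: negligible_empty intro!: negligible_subset[of "{}"])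
  also have "{0<..1} \<union> {1<..} = {0 :: real<..}" by auto
  finally show ?thesis .
qed

section \<open>The functional equation of the zeta function\<close>

lemma Digamma_reflection:
  fixes z :: complex
  assumes "z \<notin> \<int>"
  shows "Digamma z - Digamma (1 - z) = - of_real pi * cot (of_real pi * z)"
proof -
  have z: "z \<notin> \<int>\<^sub>\<le>\<^sub>0" "1 - z \<notin> \<int>\<^sub>\<le>\<^sub>0"
    using assms nonpos_Ints_subset_Ints by (auto dest!: nonpos_Ints_Int)
  have s: "sin (of_real pi * z) \<noteq> 0"
    using assms by (auto simp: sin_eq_0 mult.commute)
  have "((\<lambda>z. Gamma z * Gamma (1 - z)) has_field_derivative
      Gamma z * Gamma (1 - z) * (Digamma z - Digamma (1 - z))) (at z)"
    using z by (auto intro!: derivative_eq_intros simp: algebra_simps)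
  hence "((\<lambda>z. of_real pi / sin (of_real pi * z)) has_field_derivative
      of_real pi / sin (of_real pi * z) * (Digamma z - Digamma (1 - z))) (at z)"
    by (simp only: Gamma_reflection_complex)
  moreover have "((\<lambda>z. of_real pi / sin (of_real pi * z)) has_field_derivative
      of_real pi / sin (of_real pi * z) * (- of_real pi * cot (of_real pi * z))) (at z)"
    using s by (auto intro!: derivative_eq_intros simp: cot_def field_simps)
  ultimately have "of_real pi / sin (of_real pi * z) * (Digamma z - Digamma (1 - z)) =
      of_real pi / sin (of_real pi * z) * (- of_real pi * cot (of_real pi * z))"
    by (rule DERIV_unique)
  thus ?thesis
    using s by (subst (asm) mult_cancel_left) auto
qed

lemma cot_partial_fractions:
  fixes z :: complex
  assumes "z \<notin> \<int>"
  shows "(\<lambda>n. 2 * z / (of_nat (Suc n) ^ 2 - z ^ 2)) sums (1 / z - of_real pi * cot (of_real pi * z))"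
proof -
  have z: "z \<noteq> 0" "1 + z \<noteq> 0" "1 - z \<noteq> 0"
    using assms by (auto simp: add_eq_0_iff)
  have "(\<lambda>n. (inverse (of_nat (Suc n)) - inverse (1 + z + of_nat n)) -
      (inverse (of_nat (Suc n)) - inverse (1 - z + of_nat n))) sums (Digamma (1 + z) - Digamma (1 - z))"
    using sums_diff[OF summable_sums[OF summable_Digamma[OF z(2)]] summable_sums[OF summable_Digamma[OF z(3)]]]
    by (simp add: Digamma_def)
  moreover have "(inverse (of_nat (Suc n)) - inverse (1 + z + of_nat n)) -
      (inverse (of_nat (Suc n)) - inverse (1 - z + of_nat n)) = 2 * z / (of_nat (Suc n) ^ 2 - z ^ 2)" for n
  proof -
    have nonzero: "of_nat (Suc n) - z \<noteq> 0" "of_nat (Suc n) + z \<noteq> 0"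
      using assms by (auto simp: add_eq_0_iff simp del: of_nat_Suc)
    have shift: "1 - z + of_nat n = of_nat (Suc n) - z" "1 + z + of_nat n = of_nat (Suc n) + z"
      by simp_all
    have "of_nat (Suc n) ^ 2 - z ^ 2 = (of_nat (Suc n) - z) * (of_nat (Suc n) + z)"
      by (simp only: power2_eq_square algebra_simps)
    thus ?thesis
      using nonzero unfolding shift by (simp add: divide_simps del: of_nat_Suc) (simp add: algebra_simps)
  qed
  moreover have "Digamma (1 + z) - Digamma (1 - z) = 1 / z - of_real pi * cot (of_real pi * z)"
    using Digamma_plus1[OF z(1)] Digamma_reflection[OF assms] by (simp add: add.commute algebra_simps)
  ultimately show ?thesis by simp
qed

lemma cot_i_times:
  fixes y :: real
  assumes "y \<noteq> 0"
  shows "cot (\<i> * of_real y) = - \<i> * of_real (1 + 2 / (exp (2 * y) - 1))"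
proof -
  define E where "E = complex_of_real (exp y)"
  have "E \<noteq> 0" by (simp add: E_def)
  have E2: "complex_of_real (exp (2 * y)) = E ^ 2"
    by (simp add: E_def exp_double)
  have "exp (2 * y) \<noteq> 1" using assms by simp
  hence E2_ne_1: "E ^ 2 - 1 \<noteq> 0"
    unfolding E2[symmetric] by (metis eq_iff_diff_eq_0 of_real_eq_1_iff)
  have cos_sin: "cos (\<i> * of_real y) = (inverse E + E) / 2" "sin (\<i> * of_real y) = (inverse E - E) / (2 * \<i>)"
    by (simp_all add: cos_exp_eq sin_exp_eq E_def exp_minus exp_of_real mult.assoc[symmetric])
  have "(a / 2) / (b / (2 * \<i>)) = \<i> * a / b" for a b
    by (cases "b = 0") (simp_all add: field_simps)
  hence "cot (\<i> * of_real y) = \<i> * (inverse E + E) / (inverse E - E)"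
    unfolding cot_def cos_sin .
  also have "\<dots> = - \<i> * ((E ^ 2 + 1) / (E ^ 2 - 1))"
    using \<open>E \<noteq> 0\<close> E2_ne_1 by (simp add: divide_simps power2_eq_square) (simp add: algebra_simps)
  also have "(E ^ 2 + 1) / (E ^ 2 - 1) = of_real (1 + 2 / (exp (2 * y) - 1))"
    using E2_ne_1 assms by (simp add: E2 divide_simps)
  finally show ?thesis .
qed

definition bose :: "real \<Rightarrow> real" where
  "bose x = 1 / (exp x - 1)"

definition bose_reg :: "real \<Rightarrow> real" where
  "bose_reg x = bose x - 1 / x + 1 / 2"

lemma borel_measurable_bose [measurable]:
  "bose \<in> borel_measurable borel" "bose_reg \<in> borel_measurable borel"
  unfolding bose_reg_def[abs_def] bose_def[abs_def] by measurable

lemma bose_pos: "x > 0 \<Longrightarrow> bose x > 0"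
  by (simp add: bose_def)

lemma bose_sums:
  assumes "x > 0"
  shows "(\<lambda>n. exp (- (real (Suc n) * x))) sums bose x"
proof -
  have "(\<lambda>n. exp (-x) * exp (-x) ^ n) sums (exp (-x) * (1 / (1 - exp (-x))))"
    using assms by (intro sums_mult geometric_sums) auto
  moreover have "exp (-x) * (1 / (1 - exp (-x))) = bose x"
    using assms by (simp add: bose_def exp_minus field_simps)
  moreover have "exp (-x) * exp (-x) ^ n = exp (- (real (Suc n) * x))" for n
    by (simp add: exp_of_nat_mult[symmetric] exp_add[symmetric] algebra_simps)
  ultimately show ?thesis by simp
qed

lemma bose_reg_sums:
  assumes "x > 0"
  shows "(\<lambda>n. 2 * x / (x ^ 2 + (2 * pi * real (Suc n)) ^ 2)) sums bose_reg x"
proof -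
  define z where "z = \<i> * of_real (x / (2 * pi))"
  have "z \<notin> \<int>"
    using assms by (auto simp: z_def complex_eq_iff elim!: Ints_cases)
  have "cot (of_real pi * z) = - \<i> * of_real (1 + 2 * bose x)"
    using cot_i_times[of "x / 2"] assms by (simp add: z_def bose_def)
  hence "1 / z - of_real pi * cot (of_real pi * z) = 1 / z + of_real pi * \<i> * of_real (1 + 2 * bose x)"
    by simp
  also have "\<dots> = 2 * pi * \<i> * of_real (bose_reg x)"
    using assms by (simp add: z_def bose_reg_def field_simps)
  finally have "1 / z - of_real pi * cot (of_real pi * z) = 2 * pi * \<i> * of_real (bose_reg x)" .
  moreover have "2 * z / (of_nat (Suc n) ^ 2 - z ^ 2) =
      2 * pi * \<i> * of_real (2 * x / (x ^ 2 + (2 * pi * real (Suc n)) ^ 2))" for n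
  proof -
    have "x ^ 2 + (2 * pi * real (Suc n)) ^ 2 > 0"
      using assms by (intro add_pos_nonneg) auto
    hence "complex_of_real (x ^ 2 + (2 * pi * real (Suc n)) ^ 2) \<noteq> 0"
      unfolding of_real_eq_0_iff by linarith
    moreover have "of_nat (Suc n) ^ 2 - z ^ 2 =
        of_real (x ^ 2 + (2 * pi * real (Suc n)) ^ 2) / of_real ((2 * pi) ^ 2)"
      by (simp add: z_def field_simps del: of_nat_Suc)
    ultimately show ?thesis
      by (simp add: z_def divide_simps del: of_nat_Suc of_real_add) (simp add: power2_eq_square)
  qed
  ultimately have "(\<lambda>n. 2 * pi * \<i> * of_real (2 * x / (x ^ 2 + (2 * pi * real (Suc n)) ^ 2))) sums
      (2 * pi * \<i> * of_real (bose_reg x))"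
    using cot_partial_fractions[OF \<open>z \<notin> \<int>\<close>] by (simp only:)
  hence "(\<lambda>n. complex_of_real (2 * x / (x ^ 2 + (2 * pi * real (Suc n)) ^ 2))) sums of_real (bose_reg x)"
    by (subst (asm) sums_mult_iff) auto
  thus ?thesis by (simp only: sums_of_real_iff)
qed

lemma bose_reg_nonneg: "x > 0 \<Longrightarrow> bose_reg x \<ge> 0"
  using sums_le[OF _ sums_zero bose_reg_sums] by simp

lemma has_integral_bose:
  assumes "s > 1"
  shows "((\<lambda>x. bose x * x powr (s - 1)) has_integral Gamma s * (\<Sum>n. real (Suc n) powr (-s))) {0<..}"
proof (rule has_integral_sums_nonneg)
  show "((\<lambda>x. exp (- (real (Suc n) * x)) * x powr (s - 1))
        has_integral Gamma s * real (Suc n) powr (-s)) {0<..}" for n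
    using assms by (intro has_integral_Gamma_scaled) auto
  show "(\<lambda>n. exp (- (real (Suc n) * x)) * x powr (s - 1))
    sums (bose x * x powr (s - 1))" if "x \<in> {0<..}" for x
    using that by (intro sums_mult2 bose_sums) auto
  show "(\<lambda>n. Gamma s * real (Suc n) powr (-s)) sums (Gamma s * (\<Sum>n. real (Suc n) powr (-s)))"
    by (rule sums_mult[OF summable_sums[OF summable_nat_powr[OF assms]]])
qed simp

lemma has_integral_bose_reg:
  assumes s: "-1 < s" "s < 0"
  shows "((\<lambda>x. bose_reg x * x powr (s - 1)) has_integral
    (2 * pi) powr (s - 1) * (pi / cos (pi * s / 2)) * (\<Sum>n. real (Suc n) powr (s - 1))) {0<..}"
proof (rule has_integral_sums_nonneg)
  show "((\<lambda>x. 2 * x powr s / (x ^ 2 + (2 * pi * real (Suc n)) ^ 2)) has_integral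
      (2 * pi) powr (s - 1) * (pi / cos (pi * s / 2)) * real (Suc n) powr (s - 1)) {0<..}" for n
    using has_integral_powr_over_quadratic[of s "2 * pi * real (Suc n)"] s
    by (simp add: powr_mult mult_ac del: of_nat_Suc)
  show "(\<lambda>n. 2 * x powr s / (x ^ 2 + (2 * pi * real (Suc n)) ^ 2)) sums (bose_reg x * x powr (s - 1))"
    if "x \<in> {0<..}" for x
  proof -
    have "2 * x / (x ^ 2 + (2 * pi * real (Suc n)) ^ 2) * x powr (s - 1) =
        2 * x powr s / (x ^ 2 + (2 * pi * real (Suc n)) ^ 2)" for n
      using that by (simp add: powr_diff)
    thus ?thesis
      using sums_mult2[OF bose_reg_sums, of x "x powr (s - 1)"] that by (simp only: greaterThan_iff)
  qed
  have "summable (\<lambda>n. real (Suc n) powr (s - 1))"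
    using summable_nat_powr[of "1 - s"] s by simp
  thus "(\<lambda>n. (2 * pi) powr (s - 1) * (pi / cos (pi * s / 2)) * real (Suc n) powr (s - 1)) sums
      ((2 * pi) powr (s - 1) * (pi / cos (pi * s / 2)) * (\<Sum>n. real (Suc n) powr (s - 1)))"
    by (rule sums_mult[OF summable_sums])
qed simp

lemma bose_reg_mult_powr:
  "x > 0 \<Longrightarrow> bose_reg x * x powr (s - 1) = bose x * x powr (s - 1) - x powr (s - 1 - 1) + x powr (s - 1) / 2"
  by (simp add: bose_reg_def powr_diff power2_eq_square algebra_simps)

lemma integrable_bose_reg:
  assumes "s > -1"
  shows "integrable (lebesgue_on {0<..1}) (\<lambda>x. bose_reg x * x powr (s - 1))"
proof (rule integrable_mellin_if_has_integral)
  show "((\<lambda>x. bose_reg x * x powr (min s (-1/2) - 1)) has_integral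
      (2 * pi) powr (min s (-1/2) - 1) * (pi / cos (pi * min s (-1/2) / 2)) *
      (\<Sum>n. real (Suc n) powr (min s (-1/2) - 1))) {0<..}"
    using assms by (intro has_integral_bose_reg) auto
  show "x powr (s - 1) \<le> x powr (min s (-1/2) - 1)" if "x \<in> {0<..1}" for x
    using that by (intro powr_mono') auto
qed (auto intro: bose_reg_nonneg)

lemma integrable_bose:
  "integrable (lebesgue_on {1<..}) (\<lambda>x. bose x * x powr (s - 1))"
proof (rule integrable_mellin_if_has_integral)
  show "((\<lambda>x. bose x * x powr (max s 2 - 1)) has_integral
      Gamma (max s 2) * (\<Sum>n. real (Suc n) powr (- max s 2))) {0<..}"
    by (intro has_integral_bose) auto
  show "x powr (s - 1) \<le> x powr (max s 2 - 1)" if "x \<in> {1<..}" for x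
    using that by (intro powr_mono) auto
qed (auto intro: less_imp_le[OF bose_pos])

text \<open>The Mellin integral of \<open>bose\<close>, which is \<open>\<Gamma>(s) \<zeta>(s)\<close> for \<open>Re s > 1\<close>, with the two terms subtracted
  in \<open>bose_reg\<close> integrated explicitly over the unit interval; this form makes sense for \<open>Re s > -1\<close>.\<close>

definition Gamma_zeta_mid :: "complex \<Rightarrow> complex" where
  "Gamma_zeta_mid s = mellin_on {0<..1} bose_reg s + mellin_on {1<..} bose s + 1 / (s - 1) - 1 / (2 * s)"

text \<open>The value of \<open>\<Gamma>(s) \<zeta>(s)\<close> according to the functional equation of the zeta function.\<close>

definition Gamma_zeta_left :: "complex \<Rightarrow> complex" where
  "Gamma_zeta_left s = of_real (2 * pi) powr s * zeta_series (1 - s) / (2 * cos (of_real pi * s / 2))"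

lemma holomorphic_mellin_bose_reg: "mellin_on {0<..1} bose_reg holomorphic_on {s. Re s > -1}"
proof -
  have "mellin_on {0<..1} bose_reg holomorphic_on {s. Re s \<in> {-1<..}}"
    by (rule holomorphic_mellin_on) (auto intro: integrable_bose_reg)
  thus ?thesis by simp
qed

lemma holomorphic_mellin_bose: "mellin_on {1<..} bose holomorphic_on {s. Re s > -1}"
proof -
  have "mellin_on {1<..} bose holomorphic_on {s. Re s \<in> {-1<..}}"
    by (rule holomorphic_mellin_on) (auto intro: integrable_bose)
  thus ?thesis by simp
qed

lemma holomorphic_Gamma_zeta_mid: "Gamma_zeta_mid holomorphic_on {s. Re s > -1} - {0, 1}"
  unfolding Gamma_zeta_mid_def
  by (intro holomorphic_intros holomorphic_on_subset[OF holomorphic_mellin_bose_reg]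
      holomorphic_on_subset[OF holomorphic_mellin_bose]) auto

lemma meromorphic_Gamma_zeta_mid: "Gamma_zeta_mid meromorphic_on {s. Re s > -1}"
proof -
  have "mellin_on {0<..1} bose_reg analytic_on {s. Re s > -1}"
      "mellin_on {1<..} bose analytic_on {s. Re s > -1}"
    using holomorphic_mellin_bose_reg holomorphic_mellin_bose
    by (simp_all only: analytic_on_open open_halfspace_Re_gt)
  thus ?thesis
    unfolding Gamma_zeta_mid_def by (intro meromorphic_intros analytic_on_imp_meromorphic_on)
qed

lemma Gamma_zeta_mid_of_real:
  "Gamma_zeta_mid (of_real s) = of_real (Re (mellin_on {0<..1} bose_reg (of_real s)) +
     Re (mellin_on {1<..} bose (of_real s)) + 1 / (s - 1) - 1 / (2 * s))"
proof -
  have "mellin_on {0<..1} bose_reg (of_real s) \<in> \<real>" "mellin_on {1<..} bose (of_real s) \<in> \<real>"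
    by (subst mellin_on_of_real; auto)+
  thus ?thesis by (simp add: Gamma_zeta_mid_def)
qed

lemma Gamma_zeta_mid_real_right:
  fixes s :: real
  assumes "s > 1"
  shows "Gamma_zeta_mid (of_real s) = Gamma (of_real s) * zeta_series (of_real s)"
proof -
  let ?low = "Re (mellin_on {0<..1} bose_reg (of_real s))"
      and ?high = "Re (mellin_on {1<..} bose (of_real s))"
  have low: "((\<lambda>x. bose_reg x * x powr (s - 1)) has_integral ?low) {0<..1}"
    using assms by (intro has_integral_mellin_on integrable_bose_reg) auto
  have high: "((\<lambda>x. bose x * x powr (s - 1)) has_integral ?high) {1<..}"
    by (intro has_integral_mellin_on integrable_bose) auto
  have "((\<lambda>x. bose_reg x * x powr (s - 1) + x powr (s - 1 - 1) - x powr (s - 1) / 2)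
      has_integral ?low + 1 / (s - 1) - 1 / s / 2) {0<..1}"
    using assms by (intro has_integral_diff has_integral_add has_integral_divide low has_integral_powr_Ioc) auto
  hence "((\<lambda>x. bose x * x powr (s - 1)) has_integral ?low + 1 / (s - 1) - 1 / s / 2) {0<..1}"
    by (rule has_integral_eq[rotated]) (simp add: bose_reg_mult_powr)
  from has_integral_unique[OF has_integral_Ioc_Ioi[OF this high] has_integral_bose[OF assms]]
  have "?low + ?high + 1 / (s - 1) - 1 / (2 * s) = Gamma s * (\<Sum>n. real (Suc n) powr (-s))"
    by simp
  thus ?thesis
    unfolding Gamma_zeta_mid_of_real
    by (simp only: of_real_mult Gamma_complex_of_real[symmetric] zeta_series_of_real[OF assms])
qed

lemma Gamma_zeta_mid_real_left:
  fixes s :: real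
  assumes s: "-1 < s" "s < 0"
  shows "Gamma_zeta_mid (of_real s) = Gamma_zeta_left (of_real s)"
proof -
  let ?low = "Re (mellin_on {0<..1} bose_reg (of_real s))"
      and ?high = "Re (mellin_on {1<..} bose (of_real s))"
  have low: "((\<lambda>x. bose_reg x * x powr (s - 1)) has_integral ?low) {0<..1}"
    using s by (intro has_integral_mellin_on integrable_bose_reg) auto
  have high: "((\<lambda>x. bose x * x powr (s - 1)) has_integral ?high) {1<..}"
    by (intro has_integral_mellin_on integrable_bose) auto
  have "((\<lambda>x. bose x * x powr (s - 1) - x powr (s - 1 - 1) + x powr (s - 1) / 2)
      has_integral ?high - - 1 / (s - 1) + - 1 / s / 2) {1<..}"
    using s by (intro has_integral_diff has_integral_add has_integral_divide high has_integral_powr_Ioi) auto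
  hence "((\<lambda>x. bose_reg x * x powr (s - 1)) has_integral ?high - - 1 / (s - 1) + - 1 / s / 2) {1<..}"
    by (rule has_integral_eq[rotated]) (simp add: bose_reg_mult_powr)
  from has_integral_unique[OF has_integral_Ioc_Ioi[OF low this] has_integral_bose_reg[OF s]]
  have "?low + ?high + 1 / (s - 1) - 1 / (2 * s) =
      (2 * pi) powr s * (\<Sum>n. real (Suc n) powr (- (1 - s))) / (2 * cos (pi * s / 2))"
    by (simp add: powr_diff)
  moreover have "zeta_series (1 - of_real s) = of_real (\<Sum>n. real (Suc n) powr (- (1 - s)))"
    using zeta_series_of_real[of "1 - s"] s by simp
  moreover have "of_real (2 * pi) powr of_real s = complex_of_real ((2 * pi) powr s)"
    by (rule powr_of_real) simp
  moreover have "cos (of_real pi * of_real s / 2) = complex_of_real (cos (pi * s / 2))"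
    by (simp add: cos_of_real[symmetric])
  ultimately show ?thesis
    by (simp add: Gamma_zeta_mid_of_real Gamma_zeta_left_def)
qed

lemma holomorphic_strip_eqI:
  fixes f g :: "complex \<Rightarrow> complex" and a b :: real
  assumes f: "f holomorphic_on {s. a < Re s \<and> Re s < b}" and g: "g holomorphic_on {s. a < Re s \<and> Re s < b}"
    and eq: "\<And>x. a < x \<Longrightarrow> x < b \<Longrightarrow> f (of_real x) = g (of_real x)" and s: "a < Re s" "Re s < b"
  shows "f s = g s"
proof -
  define S where "S = {s. a < Re s} \<inter> {s. Re s < b}"
  define d where "d = (\<lambda>s. f s - g s)"
  have "d s = 0"
  proof (rule analytic_continuation[where f = d and S = S])
    have "S = {s. a < Re s \<and> Re s < b}" by (auto simp: S_def)
    thus "d holomorphic_on S"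
      unfolding d_def using f g by (auto intro: holomorphic_on_diff)
    show "open S"
      unfolding S_def by (intro open_Int open_halfspace_Re_gt open_halfspace_Re_lt)
    show "connected S"
      unfolding S_def by (intro convex_connected convex_Int convex_halfspace_Re_gt convex_halfspace_Re_lt)
    have "Re s islimpt {a<..<b}"
      using s by (intro interior_limit_point) (simp add: interior_open)
    thus "of_real (Re s) islimpt complex_of_real ` {a<..<b}"
      by (rule islimpt_isCont_image) (auto simp: eventually_at_filter)
    show "d z = 0" if "z \<in> complex_of_real ` {a<..<b}" for z
      using that eq by (auto simp: d_def)
  qed (use s in \<open>auto simp: S_def\<close>)
  thus ?thesis by (simp add: d_def)
qed

lemma cos_pi_half_nonzero:
  assumes "-1 < Re s" "Re s < 1"
  shows "cos (of_real pi * s / 2) \<noteq> 0"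
proof
  assume "cos (of_real pi * s / 2) = 0"
  then obtain n :: int where "of_real pi * s / 2 = of_real (n * pi) + of_real pi / 2"
    by (auto simp: cos_eq_0)
  hence "of_real pi * s = of_real pi * of_real (2 * n + 1)"
    by (simp add: field_simps)
  hence "Re s = of_int (2 * n + 1)" by simp
  with assms have "real_of_int (- 1) < of_int (2 * n + 1)" "real_of_int (2 * n + 1) < of_int 1"
    by simp_all
  thus False unfolding of_int_less_iff by presburger
qed

lemma Gamma_zeta_mid_right:
  assumes "Re s > 1"
  shows "Gamma_zeta_mid s = Gamma s * zeta_series s"
proof (rule holomorphic_strip_eqI[where f = Gamma_zeta_mid and g = "\<lambda>s. Gamma s * zeta_series s"
    and a = 1 and b = "Re s + 1"])
  show "Gamma_zeta_mid holomorphic_on {z. 1 < Re z \<and> Re z < Re s + 1}"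
    by (rule holomorphic_on_subset[OF holomorphic_Gamma_zeta_mid]) auto
  show "(\<lambda>s. Gamma s * zeta_series s) holomorphic_on {z. 1 < Re z \<and> Re z < Re s + 1}"
    by (intro holomorphic_intros) (auto intro!: Re_pos_not_nonpos_Ints)
qed (use assms Gamma_zeta_mid_real_right in auto)

lemma Gamma_zeta_mid_left:
  assumes "-1 < Re s" "Re s < 0"
  shows "Gamma_zeta_mid s = Gamma_zeta_left s"
proof (rule holomorphic_strip_eqI[where f = Gamma_zeta_mid and g = Gamma_zeta_left and a = "-1" and b = 0])
  show "Gamma_zeta_mid holomorphic_on {z. -1 < Re z \<and> Re z < 0}"
    by (rule holomorphic_on_subset[OF holomorphic_Gamma_zeta_mid]) auto
  show "Gamma_zeta_left holomorphic_on {z. -1 < Re z \<and> Re z < 0}"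
    unfolding Gamma_zeta_left_def by (intro holomorphic_intros) (auto simp: cos_pi_half_nonzero)
qed (use assms Gamma_zeta_mid_real_left in auto)

definition Gamma_zeta :: "complex \<Rightarrow> complex" where
  "Gamma_zeta s = (if s \<in> {s. Re s > -1} then Gamma_zeta_mid s else Gamma_zeta_left s)"

lemma Gamma_zeta_right: "Re s > 1 \<Longrightarrow> Gamma_zeta s = Gamma s * zeta_series s"
  by (simp add: Gamma_zeta_def Gamma_zeta_mid_right)

lemma Gamma_zeta_left: "Re s < 0 \<Longrightarrow> Gamma_zeta s = Gamma_zeta_left s"
  by (simp add: Gamma_zeta_def Gamma_zeta_mid_left)

lemma two_pi_not_nonpos_Reals: "complex_of_real (2 * pi) \<notin> \<real>\<^sub>\<le>\<^sub>0"
  using pi_gt_zero unfolding complex_nonpos_Reals_iff Re_complex_of_real by linarith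

lemma meromorphic_Gamma_zeta: "Gamma_zeta meromorphic_on UNIV"
  unfolding Gamma_zeta_def
proof (rule meromorphic_on_If[OF meromorphic_Gamma_zeta_mid _ _ open_halfspace_Re_gt open_halfspace_Re_lt])
  have "(\<lambda>s. zeta_series (1 - s)) holomorphic_on {s. Re s < 0}"
    by (intro holomorphic_intros) auto
  hence "(\<lambda>s. zeta_series (1 - s)) analytic_on {s. Re s < 0}"
    by (simp add: analytic_on_open open_halfspace_Re_lt)
  thus "Gamma_zeta_left meromorphic_on {s. Re s < 0}"
    unfolding Gamma_zeta_left_def using two_pi_not_nonpos_Reals
    by (intro meromorphic_on_divide meromorphic_on_mult analytic_on_imp_meromorphic_on analytic_intros)
       (auto simp del: of_real_mult)
qed (auto simp: Gamma_zeta_mid_left)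

section \<open>The L-function of the Eisenstein series\<close>

lemma has_sum_positive_iff_Suc: "(f has_sum x) {0<..} \<longleftrightarrow> ((\<lambda>n. f (Suc n)) has_sum x) UNIV"
proof -
  have "{0<..} = Suc ` UNIV" by (auto simp: image_iff gr0_conv_Suc)
  thus ?thesis by (simp add: has_sum_reindex o_def)
qed

lemma has_sum_Dirichlet_product:
  fixes f g :: "nat \<Rightarrow> complex"
  assumes f: "(f has_sum F) {0<..}" "(\<lambda>n. norm (f n)) summable_on {0<..}"
    and g: "(g has_sum G) {0<..}" "(\<lambda>n. norm (g n)) summable_on {0<..}"
  shows "((\<lambda>n. \<Sum>d | d dvd n. f d * g (n div d)) has_sum (F * G)) {0<..}"
proof -
  have "(\<lambda>x. norm (case x of (d, e) \<Rightarrow> f d * g e)) summable_on ({0<..} \<times> {0<..})"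
    unfolding Infinite_Sum.abs_summable_on_Sigma_iff using f(2) g(2)
    by (auto simp: norm_mult infsum_cmult_right' infsum_nonneg
            intro!: summable_on_cmult_right summable_on_cmult_left)
  hence "(\<lambda>(d, e). f d * g e) summable_on ({0<..} \<times> {0<..})"
    by (rule abs_summable_summable)
  hence "((\<lambda>(d, e). f d * g e) has_sum (F * G)) ({0<..} \<times> {0<..})"
    by (intro has_sum_SigmaI[where g = "\<lambda>d. f d * G"])
          (auto intro!: has_sum_cmult_right has_sum_cmult_left f g)
  also have "?this \<longleftrightarrow> ((\<lambda>(n, d). f d * g (n div d)) has_sum (F * G)) (Sigma {0<..} (\<lambda>n. {d. d dvd n}))"
    by (rule has_sum_reindex_bij_witness[of _ "\<lambda>(n, d). (d, n div d)" "\<lambda>(d, e). (d * e, d)"])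
      (auto elim!: dvdE)
  finally show ?thesis
    by (rule has_sum_SigmaD) (auto intro!: has_sum_finite)
qed

lemma has_sum_zeta_series:
  assumes "Re s > 1"
  shows "((\<lambda>n. of_nat n powr (-s)) has_sum zeta_series s) {0<..}"
    and "(\<lambda>n. norm (of_nat n powr (-s) :: complex)) summable_on {0<..}"
proof -
  show "((\<lambda>n. of_nat n powr (-s)) has_sum zeta_series s) {0<..}"
    unfolding has_sum_positive_iff_Suc
    by (rule norm_summable_imp_has_sum[OF summable_norm_zeta_series[OF assms] zeta_series_sums[OF assms]])
  have "(\<lambda>n. norm (of_nat (Suc n) powr (-s) :: complex)) summable_on UNIV"
    using summable_norm_zeta_series[OF assms] by (intro norm_summable_imp_summable_on) simp
  thus "(\<lambda>n. norm (of_nat n powr (-s) :: complex)) summable_on {0<..}"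
    unfolding summable_on_def has_sum_positive_iff_Suc .
qed

lemma divisor_sigma_Dirichlet_sums:
  fixes s :: complex
  assumes s: "Re s > real r + 1"
  shows "(\<lambda>n. of_nat (divisor_sigma r (Suc n)) * of_nat (Suc n) powr (-s)) sums
    (zeta_series (s - of_nat r) * zeta_series s)"
proof -
  have "Re (s - of_nat r) > 1" "Re s > 1" using s by auto
  hence "((\<lambda>n. \<Sum>d | d dvd n. of_nat d powr (-(s - of_nat r)) * of_nat (n div d) powr (-s)) has_sum
      (zeta_series (s - of_nat r) * zeta_series s)) {0<..}"
    by (intro has_sum_Dirichlet_product has_sum_zeta_series)
  also have "?this \<longleftrightarrow> ((\<lambda>n. of_nat (divisor_sigma r n) * of_nat n powr (-s)) has_sum
      (zeta_series (s - of_nat r) * zeta_series s)) {0<..}"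
  proof (rule has_sum_cong)
    fix n :: nat assume "n \<in> {0<..}"
    have "of_nat d powr (-(s - of_nat r)) * of_nat (n div d) powr (-s) = of_nat (d ^ r) * of_nat n powr (-s)"
      if "d dvd n" for d
    proof -
      obtain e where n: "n = d * e" using \<open>d dvd n\<close> by (elim dvdE)
      hence pos: "d > 0" "e > 0" using \<open>n \<in> {0<..}\<close> by auto
      have "of_nat d powr (-(s - of_nat r)) = of_nat (d ^ r) * (of_nat d powr (-s) :: complex)"
        using pos by (simp add: powr_diff powr_minus powr_nat field_simps)
      moreover have "of_nat n powr (-s) = of_nat d powr (-s) * (of_nat e powr (-s) :: complex)"
        unfolding n of_nat_mult by (rule powr_times_real) simp_all
      ultimately show ?thesis using pos by (simp add: n)
    qed
    thus "(\<Sum>d | d dvd n. of_nat d powr (-(s - of_nat r)) * of_nat (n div d) powr (-s)) =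
        of_nat (divisor_sigma r n) * of_nat n powr (-s)"
      by (simp add: divisor_sigma_def sum_distrib_right)
  qed
  finally show ?thesis
    unfolding has_sum_positive_iff_Suc by (rule has_sum_imp_sums)
qed

lemma summable_power_mult_geometric:
  fixes x :: real
  assumes "norm x < 1"
  shows "summable (\<lambda>n. real n ^ j * x ^ n)"
  using assms
proof (induction j arbitrary: x)
  case 0
  thus ?case by (simp add: summable_geometric)
next
  case (Suc j)
  have "summable (\<lambda>n. diffs (\<lambda>n. real n ^ j) n * x ^ n)"
    using Suc by (intro termdiff_converges[of x 1]) auto
  from summable_mult[OF this, of x] have "summable (\<lambda>n. real (Suc n) ^ Suc j * x ^ Suc n)"
    by (simp add: diffs_def algebra_simps)
  thus ?case by (subst (asm) summable_Suc_iff)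
qed

lemma divisor_sigma_le: "divisor_sigma r n \<le> n ^ Suc r"
proof (cases "n = 0")
  case False
  hence sub: "{d. d dvd n} \<subseteq> {1..n}"
    by (auto simp: Suc_le_eq dvd_pos_nat intro: dvd_imp_le)
  have "divisor_sigma r n \<le> (\<Sum>d | d dvd n. n ^ r)"
    unfolding divisor_sigma_def using False by (intro sum_mono power_mono) (auto intro: dvd_imp_le)
  also have "\<dots> \<le> n * n ^ r"
    using card_mono[OF _ sub] by simp
  finally show ?thesis by simp
qed (simp add: divisor_sigma_def)

lemma summable_divisor_sigma_power:
  fixes q :: complex
  assumes "norm q < 1"
  shows "summable (\<lambda>n. of_nat (divisor_sigma r n) * q ^ n)"
proof (rule summable_comparison_test[OF _ summable_power_mult_geometric])
  have "norm (of_nat (divisor_sigma r n) * q ^ n) \<le> real n ^ Suc r * norm q ^ n" for n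
    unfolding norm_mult norm_power norm_of_nat of_nat_power[symmetric]
    using divisor_sigma_le[of r n] by (intro mult_right_mono)
        (simp_all only: of_nat_le_iff zero_le_power norm_ge_zero)
  thus "\<exists>N. \<forall>n\<ge>N. norm (of_nat (divisor_sigma r n) * q ^ n) \<le> real n ^ Suc r * norm q ^ n" by blast
qed (use assms in simp)

lemma powser_eq_0_on_punctured_disc:
  fixes d :: "nat \<Rightarrow> complex"
  assumes sums: "\<And>q. q \<noteq> 0 \<Longrightarrow> norm q < 1 \<Longrightarrow> (\<lambda>n. d n * q ^ n) sums 0"
  shows "d n = 0"
proof (rule ccontr)
  assume "d n \<noteq> 0"
  have "((\<lambda>_. 0) \<longlongrightarrow> d 0) (at (0 :: complex))"
    using sums by (intro powser_limit_0_strong[of 1]) auto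
  hence "d 0 = 0"
    using tendsto_unique[OF _ tendsto_const] by (metis trivial_limit_at)
  with \<open>d n \<noteq> 0\<close> have "n > 0" by (cases n) auto
  have "(\<lambda>n. d n * (q - 0) ^ n) sums 0" if "norm (q - 0) < 1" for q
    using sums[of q] that \<open>d 0 = 0\<close> powser_sums_zero[of d] by (cases "q = 0") auto
  then obtain s :: real where "0 < s" "\<And>z :: complex. z \<in> cball 0 s - {0} \<Longrightarrow> (0 :: complex) \<noteq> 0"
    using powser_0_nonzero[of 1 0 d "\<lambda>_. 0" n] \<open>d n \<noteq> 0\<close> \<open>n > 0\<close> zero_less_one by blast
  from this(2)[of "of_real s"] \<open>0 < s\<close> show False by simp
qed

lemma Fourier_series_unique:
  fixes a b :: "nat \<Rightarrow> complex"
  assumes a: "\<And>\<tau>. Im \<tau> > 0 \<Longrightarrow> (\<lambda>n. a n * exp (2 * of_real pi * \<i> * of_nat n * \<tau>)) sums f \<tau>"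
    and b: "\<And>\<tau>. Im \<tau> > 0 \<Longrightarrow> (\<lambda>n. b n * exp (2 * of_real pi * \<i> * of_nat n * \<tau>)) sums f \<tau>"
  shows "a = b"
proof -
  have "(\<lambda>n. (a n - b n) * q ^ n) sums 0" if q: "q \<noteq> 0" "norm q < 1" for q
  proof -
    define \<tau> where "\<tau> = Ln q / (2 * of_real pi * \<i>)"
    have "Im \<tau> = - Re (Ln q) / (2 * pi)"
      by (simp add: \<tau>_def Im_divide power2_eq_square)
    also have "\<dots> > 0" using q by (simp add: field_simps)
    finally have "Im \<tau> > 0" .
    have "exp (2 * of_real pi * \<i> * of_nat n * \<tau>) = q ^ n" for n
    proof -
      have arg: "2 * of_real pi * \<i> * of_nat n * \<tau> = of_nat n * Ln q"
        by (simp add: \<tau>_def)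
      show ?thesis unfolding arg using q by (simp add: exp_of_nat_mult)
    qed
    with sums_diff[OF a[OF \<open>Im \<tau> > 0\<close>] b[OF \<open>Im \<tau> > 0\<close>]] show ?thesis
      by (simp add: left_diff_distrib)
  qed
  from powser_eq_0_on_punctured_disc[OF this] show ?thesis by (simp add: fun_eq_iff)
qed

definition eisenstein_const :: "nat \<Rightarrow> real" where
  "eisenstein_const k = (2 * pi) ^ k / (zeta_nat k * Gamma (real k))"

definition eisenstein_coeff :: "nat \<Rightarrow> nat \<Rightarrow> complex" where
  "eisenstein_coeff k n = (if n = 0 then 1
        else of_real (eisenstein_const k) * of_nat (divisor_sigma (k - 1) n))"

lemma eisenstein_sums:
  assumes "Im \<tau> > 0"
  shows "(\<lambda>n. eisenstein_coeff k n * exp (2 * of_real pi * \<i> * of_nat n * \<tau>)) sums eisenstein_E k \<tau>"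
proof -
  define q where "q = exp (2 * of_real pi * \<i> * \<tau>)"
  have q_pow: "exp (2 * of_real pi * \<i> * of_nat n * \<tau>) = q ^ n" for n
    unfolding q_def exp_of_nat_mult[symmetric] by (simp add: algebra_simps)
  have "norm q < 1" using assms by (simp add: q_def)
  hence "summable (\<lambda>n. of_nat (divisor_sigma (k - 1) (Suc n)) * q ^ Suc n)"
    by (subst summable_Suc_iff) (rule summable_divisor_sigma_power)
  from sums_mult[OF summable_sums[OF this], of "of_real (eisenstein_const k)"]
  have "(\<lambda>n. eisenstein_coeff k (Suc n) * q ^ Suc n) sums
      (of_real (eisenstein_const k) * (\<Sum>n. of_nat (divisor_sigma (k - 1) (Suc n)) * q ^ Suc n))"
    by (simp add: eisenstein_coeff_def mult.assoc)
  from sums_Suc[OF this] show ?thesis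
    unfolding eisenstein_E_def q_pow by (simp add: eisenstein_coeff_def eisenstein_const_def add.commute)
qed

lemma fourier_coeff_eisenstein: "fourier_coeff (eisenstein_E k) = eisenstein_coeff k"
  unfolding fourier_coeff_def
proof (rule the_equality)
  fix a assume "\<forall>\<tau>. Im \<tau> > 0 \<longrightarrow> (\<lambda>n. a n * exp (2 * of_real pi * \<i> * of_nat n * \<tau>)) sums eisenstein_E k \<tau>"
  thus "a = eisenstein_coeff k"
    using eisenstein_sums by (intro Fourier_series_unique[of _ "eisenstein_E k"]) auto
qed (use eisenstein_sums in blast)

lemma L_series_eisenstein:
  assumes "Re s > real k" "k > 0"
  shows "L_series (eisenstein_E k) s =
    of_real (eisenstein_const k) * (zeta_series (s - of_nat k + 1) * zeta_series s)"
proof -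
  have shift: "s - of_nat (k - 1) = s - of_nat k + 1" using assms by (simp add: of_nat_diff)
  have "Re s > real (k - 1) + 1" using assms by (simp add: of_nat_diff)
  from sums_mult[OF divisor_sigma_Dirichlet_sums[OF this], of "of_real (eisenstein_const k)"]
  show ?thesis
    unfolding L_series_def fourier_coeff_eisenstein shift
    by (simp add: eisenstein_coeff_def sums_iff mult.assoc del: of_nat_Suc)
qed

lemma remove_sings_nicely_meromorphic_eq:
  assumes "f nicely_meromorphic_on A" "z \<in> A"
  shows "remove_sings f z = f z"
  using assms by (auto simp: nicely_meromorphic_on_def intro: remove_sings_eqI)

lemma nicely_meromorphic_halfplane_eqI:
  assumes f: "f nicely_meromorphic_on UNIV" and g: "g nicely_meromorphic_on UNIV"
    and eq: "\<And>s. Re s > c \<Longrightarrow> f s = g s"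
  shows "f = g"
proof
  fix z
  define d where "d = (\<lambda>s. f s - g s)"
  have "d meromorphic_on UNIV"
    using f g unfolding d_def nicely_meromorphic_on_def by (intro meromorphic_intros) auto
  moreover have "\<not> eventually (\<lambda>s. d s \<noteq> 0) (cosparse UNIV)"
  proof
    assume "eventually (\<lambda>s. d s \<noteq> 0) (cosparse UNIV)"
    hence "eventually (\<lambda>s. d s \<noteq> 0) (at (of_real (c + 1)))"
      by (simp add: eventually_cosparse_open_eq)
    moreover have "eventually (\<lambda>s. d s = 0) (at (of_real (c + 1)))"
      using eventually_at_in_open'[OF open_halfspace_Re_gt, of "of_real (c + 1)" c]
      by (auto elim!: eventually_mono simp: d_def eq)
    ultimately have "eventually (\<lambda>_. False) (at (complex_of_real (c + 1)))"
      by eventually_elim simp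
    thus False by simp
  qed
  ultimately have "eventually (\<lambda>s. d s = 0) (cosparse UNIV)"
    using meromorphic_imp_constant_or_avoid[of d UNIV 0] by (auto simp: connected_UNIV)
  hence "eventually (\<lambda>s. f s = g s) (at z)"
    by (simp add: eventually_cosparse_open_eq d_def)
  hence "remove_sings f z = remove_sings g z"
    by (rule remove_sings_cong) simp
  thus "f z = g z"
    using f g by (simp add: remove_sings_nicely_meromorphic_eq)
qed

lemma meromorphic_continuation_eqI:
  assumes G: "G meromorphic_on UNIV" and G_analytic: "G analytic_on {s. Re s > c}"
    and FG: "\<And>s. Re s > c \<Longrightarrow> F s = G s"
  shows "meromorphic_continuation F = remove_sings G"
  unfolding meromorphic_continuation_def
proof (rule the_equality)
  have nice: "remove_sings G nicely_meromorphic_on UNIV"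
    by (rule remove_sings_nicely_meromorphic[OF G])
  have cont: "remove_sings G s = F s" if "Re s > c" for s
    using that FG analytic_on_subset[OF G_analytic, of "{s}"] by simp
  show "remove_sings G nicely_meromorphic_on UNIV \<and> (\<exists>c::real. \<forall>s. Re s > c \<longrightarrow> remove_sings G s = F s)"
    using nice cont by blast
  fix H assume H: "H nicely_meromorphic_on UNIV \<and> (\<exists>c::real. \<forall>s. Re s > c \<longrightarrow> H s = F s)"
  then obtain c' where "\<And>s. Re s > c' \<Longrightarrow> H s = F s" by blast
  thus "H = remove_sings G"
    using H nice cont by (intro nicely_meromorphic_halfplane_eqI[where c = "max c c'"]) auto
qed

definition eisenstein_Lambda :: "nat \<Rightarrow> complex \<Rightarrow> complex" where
  "eisenstein_Lambda k s = of_real (eisenstein_const k) *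
     (of_real (2 * pi) powr (-s) *
           (Gamma_zeta s * (Gamma_zeta (s - of_nat k + 1) * rGamma (s - of_nat k + 1))))"

lemma meromorphic_eisenstein_Lambda: "eisenstein_Lambda k meromorphic_on UNIV"
proof -
  have "(\<lambda>s. Gamma_zeta (s - of_nat k + 1)) meromorphic_on UNIV"
    by (rule meromorphic_on_compose[OF meromorphic_Gamma_zeta]) (auto intro!: analytic_intros)
  thus ?thesis
    unfolding eisenstein_Lambda_def using two_pi_not_nonpos_Reals
    by (intro meromorphic_on_mult meromorphic_Gamma_zeta meromorphic_on_const)
       (auto intro!: analytic_on_imp_meromorphic_on analytic_intros simp del: of_real_mult)
qed

lemma eisenstein_Lambda_right:
  assumes "Re s > real k" "k > 0"
  shows "eisenstein_Lambda k s = of_real (2 * pi) powr (-s) * Gamma s *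
    (of_real (eisenstein_const k) * (zeta_series (s - of_nat k + 1) * zeta_series s))"
proof -
  have "real k \<ge> 1" using assms by simp
  hence Re: "Re (s - of_nat k + 1) > 1" "Re s > 1" using assms by auto
  have "s - of_nat k + 1 \<notin> \<int>\<^sub>\<le>\<^sub>0" by (rule Re_pos_not_nonpos_Ints) (use Re in simp)
  hence "Gamma (s - of_nat k + 1) * rGamma (s - of_nat k + 1) = 1"
    by (simp add: Gamma_def rGamma_eq_zero_iff)
  thus ?thesis
    unfolding eisenstein_Lambda_def Gamma_zeta_right[OF Re(1)] Gamma_zeta_right[OF Re(2)]
    by (simp add: mult_ac)
qed

lemma analytic_eisenstein_Lambda:
  assumes "k > 0"
  shows "eisenstein_Lambda k analytic_on {s. Re s > real k}"
proof -
  have "s \<notin> \<int>\<^sub>\<le>\<^sub>0" if "Re s > real k" for s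
    using order.strict_trans1[OF of_nat_0_le_iff that] by (rule Re_pos_not_nonpos_Ints)
  moreover have "real k \<ge> 1" using assms by simp
  ultimately have "(\<lambda>s. of_real (2 * pi) powr (-s) * Gamma s *
      (of_real (eisenstein_const k) * (zeta_series (s - of_nat k + 1) * zeta_series s)))
          holomorphic_on {s. Re s > real k}"
    using two_pi_not_nonpos_Reals
    by (intro holomorphic_intros) (auto simp del: of_real_mult)
  thus ?thesis
    unfolding analytic_on_open[OF open_halfspace_Re_gt]
    by (rule holomorphic_transform) (simp add: eisenstein_Lambda_right assms)
qed

lemma completed_L_eisenstein_eq:
  assumes "k > 0"
  shows "completed_L (eisenstein_E k) = remove_sings (eisenstein_Lambda k)"
  unfolding completed_L_def
  by (rule meromorphic_continuation_eqI[OF meromorphic_eisenstein_Lambda analytic_eisenstein_Lambda[OF assms]])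
    (simp add: L_series_eisenstein eisenstein_Lambda_right assms)

definition Lambda_strip :: "nat \<Rightarrow> complex \<Rightarrow> complex" where
  "Lambda_strip k s = reflect_mult (of_nat k / 2) Gamma s * reflect_mult (of_nat k / 2) zeta_series s"

definition Lambda_const :: "nat \<Rightarrow> complex" where
  "Lambda_const k = of_real (eisenstein_const k) * of_real (2 * pi) powr (1 - of_nat k) / of_real pi"

lemma sin_cos_pi_shift_multiple_of_4:
  fixes s :: complex
  assumes "4 dvd k"
  shows "sin (of_real pi * (of_nat k - s)) = - 2 * sin (of_real pi * s / 2) * cos (of_real pi * s / 2)"
    and "cos (of_real pi * (s - of_nat k + 1) / 2) = - sin (of_real pi * s / 2)"
proof -
  obtain q where q: "k = 4 * q" using assms by (elim dvdE)
  define A where "A = complex_of_real (2 * real q * pi)"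
  define x where "x = of_real pi * s / 2"
  have A: "cos A = 1" "sin A = 0"
    unfolding A_def cos_of_real sin_of_real by (simp_all only: cos_2npi sin_2npi of_real_1 of_real_0)
  have args: "of_real pi * (of_nat k - s) = (A + A) - (x + x)"
    "of_real pi * (s - of_nat k + 1) / 2 = x + of_real pi / 2 - A"
    by (simp_all add: x_def A_def q field_simps)
  show "sin (of_real pi * (of_nat k - s)) = - 2 * sin (of_real pi * s / 2) * cos (of_real pi * s / 2)"
    unfolding args x_def[symmetric] sin_diff sin_add cos_add A by simp
  show "cos (of_real pi * (s - of_nat k + 1) / 2) = - sin (of_real pi * s / 2)"
    unfolding args x_def[symmetric] cos_diff cos_add A by simp
qed

lemma eisenstein_Lambda_strip:
  assumes k: "4 dvd k" and s: "1 < Re s" "Re s < real k - 1" and nz: "sin (of_real pi * s / 2) \<noteq> 0"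
  shows "eisenstein_Lambda k s = Lambda_const k * Lambda_strip k s * cos (of_real pi * s / 2)"
proof -
  define w where "w = s - of_nat k + 1"
  have "of_nat k - s \<notin> \<int>\<^sub>\<le>\<^sub>0"
    using s by (intro Re_pos_not_nonpos_Ints) simp
  hence "rGamma (of_nat k - s) \<noteq> 0" by (simp add: rGamma_eq_zero_iff)
  moreover have "rGamma (of_nat k - s) * rGamma w = sin (of_real pi * (of_nat k - s)) / of_real pi"
    using rGamma_reflection_complex[of "of_nat k - s"] by (simp add: w_def algebra_simps)
  ultimately have rGamma_w: "rGamma w =
      Gamma (of_nat k - s) * (- 2 * sin (of_real pi * s / 2) * cos (of_real pi * s / 2)) / of_real pi"
    unfolding sin_cos_pi_shift_multiple_of_4(1)[OF k] by (simp add: Gamma_def field_simps)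
  have "Re w < 0" "1 - w = of_nat k - s" using s by (simp_all add: w_def)
  hence Gamma_zeta_w: "Gamma_zeta w =
      of_real (2 * pi) powr w * zeta_series (of_nat k - s) / (2 * (- sin (of_real pi * s / 2)))"
    by (simp add: Gamma_zeta_left Gamma_zeta_left_def w_def sin_cos_pi_shift_multiple_of_4(2)[OF k])
  have "of_real (2 * pi) powr (-s) * of_real (2 * pi) powr w = complex_of_real (2 * pi) powr (1 - of_nat k)"
    by (simp add: w_def powr_add[symmetric] algebra_simps)
  hence "Lambda_const k = of_real (eisenstein_const k) *
      (of_real (2 * pi) powr (-s) * of_real (2 * pi) powr w) / of_real pi"
    by (simp add: Lambda_const_def)
  thus ?thesis
    using nz unfolding eisenstein_Lambda_def w_def[symmetric] Gamma_zeta_w rGamma_w Gamma_zeta_right[OF s(1)]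
      Lambda_strip_def reflect_mult_half by (simp add: field_simps)
qed

definition critical_strip :: "nat \<Rightarrow> complex set" where
  "critical_strip k = {s. 1 < Re s \<and> Re s < real k - 1}"

lemma open_critical_strip: "open (critical_strip k)"
proof -
  have "critical_strip k = {s. Re s > 1} \<inter> {s. Re s < real k - 1}" by (auto simp: critical_strip_def)
  thus ?thesis by (simp add: open_Int open_halfspace_Re_gt open_halfspace_Re_lt)
qed

lemma analytic_Lambda_strip: "Lambda_strip k analytic_on critical_strip k"
proof -
  have "Lambda_strip k holomorphic_on critical_strip k"
    unfolding Lambda_strip_def reflect_mult_half critical_strip_def
    by (intro holomorphic_intros) (auto intro!: Re_pos_not_nonpos_Ints)
  thus ?thesis by (simp add: analytic_on_open open_critical_strip)
qed

lemma eventually_sin_nonzero: "eventually (\<lambda>w :: complex. sin (of_real pi * w / 2) \<noteq> 0) (at z)"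
proof (rule ccontr)
  assume "\<not> eventually (\<lambda>w :: complex. sin (of_real pi * w / 2) \<noteq> 0) (at z)"
  hence limpt: "z islimpt {w. sin (of_real pi * w / 2) = 0}"
    by (simp add: islimpt_conv_frequently_at frequently_def)
  have "sin (of_real pi * 1 / 2 :: complex) = 0"
  proof (rule analytic_continuation[where f = "\<lambda>w. sin (of_real pi * w / 2)"
        and S = UNIV and w = 1, OF _ _ _ _ _ limpt])
    show "(\<lambda>w. sin (of_real pi * w / 2) :: complex) holomorphic_on UNIV"
      by (intro holomorphic_intros) simp
  qed (simp_all add: connected_UNIV)
  moreover have "of_real pi * 1 / 2 = complex_of_real (pi / 2)" by simp
  ultimately show False by (simp only: sin_of_real) simp
qed

lemma completed_L_eisenstein:
  assumes k: "4 dvd k" "k > 0" and s: "s \<in> critical_strip k"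
  shows "completed_L (eisenstein_E k) s = Lambda_const k * Lambda_strip k s * cos (of_real pi * s / 2)"
proof -
  have "eventually (\<lambda>z. z \<in> critical_strip k) (at s)"
    by (rule eventually_at_in_open'[OF open_critical_strip s])
  hence "eventually (\<lambda>z. eisenstein_Lambda k z =
        Lambda_const k * Lambda_strip k z * cos (of_real pi * z / 2)) (at s)"
    using eventually_sin_nonzero[of s]
    by eventually_elim (simp add: eisenstein_Lambda_strip[OF k(1)] critical_strip_def)
  hence "remove_sings (eisenstein_Lambda k) s =
      remove_sings (\<lambda>z. Lambda_const k * Lambda_strip k z * cos (of_real pi * z / 2)) s"
    by (rule remove_sings_cong) simp
  moreover have "(\<lambda>z. Lambda_const k * Lambda_strip k z * cos (of_real pi * z / 2)) analytic_on {s}"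
    using analytic_on_subset[OF analytic_Lambda_strip, of "{s}" k] s by (auto intro!: analytic_intros)
  ultimately show ?thesis
    by (simp add: completed_L_eisenstein_eq[OF k(2)])
qed

lemma Lambda_const_nonzero:
  assumes "k \<ge> 2"
  shows "Lambda_const k \<noteq> 0"
proof -
  have "summable (\<lambda>n. 1 / real (Suc n) ^ k)"
    using inverse_power_summable[of k, where ?'a = real] assms
    by (subst summable_Suc_iff) (simp add: divide_inverse)
  hence "zeta_nat k > 0"
    unfolding zeta_nat_def by (rule suminf_pos) simp
  moreover have "Gamma (real k) > 0" using assms by (intro Gamma_real_pos) auto
  ultimately show ?thesis by (simp add: Lambda_const_def eisenstein_const_def)
qed

lemma higher_deriv_completed_L_tilde:
  assumes k: "4 dvd k" "k > 0" and n: "even n" "of_nat n \<in> critical_strip k"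
  shows "(deriv ^^ m) (completed_L_tilde (eisenstein_E k)) (of_nat n) =
    Lambda_const k * (deriv ^^ m) (Lambda_strip k) (of_nat n)"
proof -
  obtain j where "n = 2 * j" using \<open>even n\<close> by (elim evenE)
  hence "cos (of_real pi * of_nat n / 2) = complex_of_real (cos (real j * pi))"
    by (simp add: cos_of_real[symmetric] mult.commute)
  hence "cos (of_real pi * of_nat n / 2) \<noteq> (0 :: complex)" by simp
  moreover have "isCont (\<lambda>s. cos (of_real pi * s / 2) :: complex) (of_nat n)"
    by (intro continuous_intros) simp
  ultimately have "eventually (\<lambda>z. cos (of_real pi * z / 2) \<noteq> (0 :: complex)) (nhds (of_nat n))"
    by (simp add: isCont_def tendsto_imp_eventually_ne eventually_nhds_conv_at)
  moreover have "eventually (\<lambda>z. z \<in> critical_strip k) (nhds (of_nat n))"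
    by (rule eventually_nhds_in_open[OF open_critical_strip n(2)])
  ultimately have "eventually (\<lambda>z. completed_L_tilde (eisenstein_E k) z =
        Lambda_const k * Lambda_strip k z) (nhds (of_nat n))"
    by eventually_elim (simp add: completed_L_tilde_def completed_L_eisenstein[OF k])
  hence "(deriv ^^ m) (completed_L_tilde (eisenstein_E k)) (of_nat n) =
      (deriv ^^ m) (\<lambda>z. Lambda_const k * Lambda_strip k z) (of_nat n)"
    by (rule higher_deriv_cong_ev) simp
  also have "\<dots> = Lambda_const k * (deriv ^^ m) (Lambda_strip k) (of_nat n)"
    using n(2) by (intro higher_deriv_cmult' analytic_on_subset[OF analytic_Lambda_strip]) auto
  finally show ?thesis .
qed

section \<open>Zeros of the period polynomial\<close>

lemma ball_subset_critical_strip: "ball (of_nat k / 2) (real k / 2 - 1) \<subseteq> critical_strip k"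
  using Re_gt_in_ball[of _ "of_nat k / 2" "real k / 2 - 1"] by (fastforce simp: critical_strip_def)

definition Lambda_quotient :: "nat \<Rightarrow> nat \<Rightarrow> complex \<Rightarrow> complex" where
  "Lambda_quotient k m =
     twisted_deriv (reflect_diff (of_nat k / 2) Digamma) (reflect_mult (of_nat k / 2) zeta_series) m"

context
  fixes k :: nat
  assumes k: "2 < k"
begin

lemma nonneg_taylor_Digamma_at_half_weight:
  "nonneg_taylor (of_nat k / 2) (real k / 2 - 1) (reflect_diff (of_nat k / 2) Digamma)"
  using nonneg_taylor_subset[OF nonneg_taylor_reflect_diff_Digamma[of "real k / 2"], of "real k / 2 - 1"] k
  by simp

lemma nonneg_taylor_zeta_at_half_weight:
  "nonneg_taylor (of_nat k / 2) (real k / 2 - 1) (reflect_mult (of_nat k / 2) zeta_series)"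
  using k nonneg_taylor_reflect_mult_zeta[of "real k / 2"] by simp

lemma nonneg_taylor_Lambda_quotient:
  "nonneg_taylor (of_nat k / 2) (real k / 2 - 1) (Lambda_quotient k m)"
  unfolding Lambda_quotient_def
  by (rule nonneg_taylor_twisted_deriv[OF nonneg_taylor_Digamma_at_half_weight
        nonneg_taylor_zeta_at_half_weight])

lemma higher_deriv_Lambda_strip:
  assumes s: "s \<in> ball (of_nat k / 2) (real k / 2 - 1)"
  shows "(deriv ^^ m) (Lambda_strip k) s = Gamma s * Gamma (of_nat k - s) * Lambda_quotient k m s"
  unfolding Lambda_strip_def[abs_def] Lambda_quotient_def reflect_mult_half[of _ Gamma, symmetric]
proof (rule higher_deriv_mult_eq_twisted_deriv[OF _ _ open_ball s])
  fix s :: complex assume "s \<in> ball (of_nat k / 2) (real k / 2 - 1)"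
  hence "s \<in> critical_strip k" using ball_subset_critical_strip by blast
  hence "s \<notin> \<int>\<^sub>\<le>\<^sub>0" "of_nat k - s \<notin> \<int>\<^sub>\<le>\<^sub>0"
    by (auto simp: critical_strip_def intro!: Re_pos_not_nonpos_Ints)
  thus "(reflect_mult (of_nat k / 2) Gamma has_field_derivative
      reflect_diff (of_nat k / 2) Digamma s * reflect_mult (of_nat k / 2) Gamma s) (at s)"
    unfolding reflect_mult_def reflect_diff_def
    by (auto intro!: derivative_eq_intros simp: algebra_simps)
qed (use nonneg_taylor_Digamma_at_half_weight nonneg_taylor_zeta_at_half_weight
    in \<open>simp_all add: nonneg_taylor_def\<close>)

lemma Lambda_quotient_reflect:
  assumes s: "s \<in> ball (of_nat k / 2) (real k / 2 - 1)"
  shows "Lambda_quotient k m (of_nat k - s) = (-1) ^ m * Lambda_quotient k m s"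
proof -
  have "Lambda_quotient k m (2 * (of_nat k / 2) - s) = (-1) ^ m * Lambda_quotient k m s"
    unfolding Lambda_quotient_def
  proof (rule twisted_deriv_reflect[OF _ _ open_ball s])
    show "2 * (of_nat k / 2) - s \<in> ball (of_nat k / 2) (real k / 2 - 1)"
      if "s \<in> ball (of_nat k / 2) (real k / 2 - 1)" for s :: complex
      using that unfolding mem_ball dist_reflect .
  qed (use nonneg_taylor_Digamma_at_half_weight nonneg_taylor_zeta_at_half_weight in
      \<open>simp_all only: nonneg_taylor_def reflect_diff_reflect reflect_mult_reflect\<close>)
  thus ?thesis by simp
qed

lemma Lambda_quotient_pos:
  assumes "0 \<le> x" "x < real k / 2 - 1" and "even m \<or> 0 < x"
  shows "0 < Re (Lambda_quotient k m (of_nat k / 2 + of_real x))"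
  unfolding Lambda_quotient_def
proof (rule twisted_deriv_pos[OF nonneg_taylor_Digamma_at_half_weight
    nonneg_taylor_zeta_at_half_weight _ _ assms])
  show "0 < Re (deriv (reflect_diff (of_nat k / 2) Digamma) (of_nat k / 2))"
    using k deriv_reflect_diff_Digamma_pos[of "real k / 2"] by simp
  have "zeta_series (of_nat k / 2) = of_real (\<Sum>n. real (Suc n) powr - (real k / 2))"
    "0 < Re (zeta_series (of_nat k / 2))"
    using k zeta_series_of_real[of "real k / 2"] zeta_series_real_pos[of "real k / 2"] by simp_all
  thus "0 < Re (reflect_mult (of_nat k / 2) zeta_series (of_nat k / 2))"
    by (simp add: reflect_mult_half)
qed

end

lemma binomial_mult_Gamma:
  assumes "n \<le> K"
  shows "of_nat (K choose n) * (Gamma (of_nat (n + 1)) * Gamma (of_nat (K + 2) - of_nat (n + 1))) =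
        (fact K :: complex)"
proof -
  have "of_nat (K + 2) - of_nat (n + 1) = (1 + of_nat (K - n) :: complex)"
    using assms by (simp add: of_nat_diff)
  hence "Gamma (of_nat (n + 1)) = (fact n :: complex)"
      "Gamma (of_nat (K + 2) - of_nat (n + 1)) = (fact (K - n) :: complex)"
    using Gamma_fact[of n, where ?'a = complex] by (simp_all only: Gamma_fact of_nat_add of_nat_1 add.commute)
  thus ?thesis
    using arg_cong[OF binomial_fact_lemma[OF assms], of complex_of_nat] by (simp add: mult_ac)
qed

lemma i_powi_one_minus_odd: "\<i> powi (1 - int (2 * l + 1)) = (-1) ^ l"
proof -
  have exponent: "1 - int (2 * l + 1) = - int (2 * l)" by simp
  show ?thesis
    unfolding exponent power_int_minus power_int_of_nat by (simp add: power_mult flip: power_inverse)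
qed

lemma power_even_eq_minus_square_power: "(-1) ^ l * z ^ (2 * n) =
    (-1) ^ (l + n) * (- (z ^ 2)) ^ n" for z :: complex
  by (simp add: power_mult power_add power_minus[of "z ^ 2"] mult.assoc)

definition Lambda_quotient_poly :: "nat \<Rightarrow> nat \<Rightarrow> real poly" where
  "Lambda_quotient_poly N m = (\<Sum>j\<le>2 * N. monom (Re (Lambda_quotient (4 * N + 4) m (of_nat (2 * j + 2)))) j)"

context
  fixes k N :: nat
  assumes k: "k = 4 * N + 4"
begin

lemma half_weight: "real k / 2 = 2 * real N + 2"
  by (simp add: k)

lemma even_point_centered: "complex_of_nat (2 * j + 2) = of_nat k / 2 + of_real (2 * (real j - real N))"
  by (simp add: k algebra_simps)

lemma even_point_range:
  assumes "j \<le> 2 * N"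
  shows "\<bar>2 * (real j - real N)\<bar> < real k / 2 - 1"
proof -
  have "real j \<le> 2 * real N" using assms by linarith
  thus ?thesis by (simp add: half_weight abs_less_iff)
qed

lemma even_point_in_ball:
  assumes "j \<le> 2 * N"
  shows "complex_of_nat (2 * j + 2) \<in> ball (of_nat k / 2) (real k / 2 - 1)"
proof -
  have "dist (of_nat k / 2) (complex_of_nat (2 * j + 2)) = \<bar>2 * (real j - real N)\<bar>"
    unfolding even_point_centered dist_norm norm_minus_commute[of "of_nat k / 2"]
          add_diff_cancel_left' norm_of_real ..
  thus ?thesis using even_point_range[OF assms] by simp
qed

lemma coeff_Lambda_quotient_poly:
  "coeff (Lambda_quotient_poly N m) j =
       (if j \<le> 2 * N then Re (Lambda_quotient k m (of_nat (2 * j + 2))) else 0)"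
proof -
  have "coeff (Lambda_quotient_poly N m) j =
        (\<Sum>i\<le>2 * N. if i = j then Re (Lambda_quotient k m (of_nat (2 * i + 2))) else 0)"
    by (simp only: Lambda_quotient_poly_def coeff_sum coeff_monom k)
  thus ?thesis by simp
qed

lemma map_poly_Lambda_quotient_poly:
  "map_poly complex_of_real (Lambda_quotient_poly N m) =
     (\<Sum>j\<le>2 * N. monom (of_real (coeff (Lambda_quotient_poly N m) j)) j)"
  by (rule poly_eqI) (auto simp: coeff_map_poly coeff_sum coeff_Lambda_quotient_poly)

lemma of_real_coeff_Lambda_quotient_poly:
  assumes "j \<le> 2 * N"
  shows "of_real (coeff (Lambda_quotient_poly N m) j) = Lambda_quotient k m (of_nat (2 * j + 2))"
proof -
  have "2 < k" by (simp add: k)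
  have "Lambda_quotient k m (of_nat (2 * j + 2)) \<in> \<real>"
    unfolding even_point_centered
    by (rule nonneg_taylor_real[OF nonneg_taylor_Lambda_quotient[OF \<open>2 < k\<close>] even_point_range[OF assms]])
  thus ?thesis using assms by (simp add: coeff_Lambda_quotient_poly)
qed

lemma coeff_Lambda_quotient_poly_upper:
  assumes "i \<le> N"
  shows "coeff (Lambda_quotient_poly N m) (N + i) =
        Re (Lambda_quotient k m (of_nat k / 2 + of_real (2 * real i)))"
proof -
  have "N + i \<le> 2 * N" "real (N + i) - real N = real i" using assms by simp_all
  thus ?thesis by (simp only: coeff_Lambda_quotient_poly even_point_centered if_True)
qed

lemma coeff_Lambda_quotient_poly_reflect:
  assumes "j \<le> 2 * N"
  shows "coeff (Lambda_quotient_poly N m) (2 * N - j) = (-1) ^ m * coeff (Lambda_quotient_poly N m) j"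
proof -
  have "2 < k" by (simp add: k)
  have "complex_of_nat (2 * (2 * N - j) + 2) = of_nat k - of_nat (2 * j + 2)"
    using assms by (simp add: k of_nat_diff)
  hence "complex_of_real (coeff (Lambda_quotient_poly N m) (2 * N - j)) =
      (-1) ^ m * of_real (coeff (Lambda_quotient_poly N m) j)"
    using assms Lambda_quotient_reflect[OF \<open>2 < k\<close> even_point_in_ball[OF assms]]
    by (simp only: of_real_coeff_Lambda_quotient_poly diff_le_self)
  also have "\<dots> = of_real ((-1) ^ m * coeff (Lambda_quotient_poly N m) j)"
    by simp
  finally show ?thesis by (simp only: of_real_eq_iff)
qed

lemma coeff_Lambda_quotient_poly_mono:
  assumes "i < N"
  shows "coeff (Lambda_quotient_poly N m) (N + i) \<le> coeff (Lambda_quotient_poly N m) (N + Suc i)"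
proof -
  have "2 < k" by (simp add: k)
  have "2 * real (Suc i) < real k / 2 - 1"
    using assms by (simp add: half_weight)
  thus ?thesis
    using assms nonneg_taylor_mono[OF nonneg_taylor_Lambda_quotient[OF \<open>2 < k\<close>],
          of "2 * real i" "2 * real (Suc i)" m]
    by (simp add: coeff_Lambda_quotient_poly_upper del: of_nat_Suc add_Suc_right)
qed

lemma coeff_Lambda_quotient_poly_middle: "0 \<le> coeff (Lambda_quotient_poly N m) N"
proof -
  have "2 < k" by (simp add: k)
  thus ?thesis
    using nonneg_taylor_center[OF nonneg_taylor_Lambda_quotient[OF \<open>2 < k\<close>, of m]]
      coeff_Lambda_quotient_poly_upper[of 0 m] by (simp add: complex_nonneg_Reals_iff)
qed

lemma coeff_Lambda_quotient_poly_top: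
  assumes "even m \<or> 0 < N"
  shows "0 < coeff (Lambda_quotient_poly N m) (2 * N)"
proof -
  have "2 < k" by (simp add: k)
  moreover have "2 * real N < real k / 2 - 1" by (simp add: half_weight)
  moreover have "coeff (Lambda_quotient_poly N m) (2 * N) =
        Re (Lambda_quotient k m (of_nat k / 2 + of_real (2 * real N)))"
    using coeff_Lambda_quotient_poly_upper[OF order_refl] by (simp only: mult_2[symmetric])
  ultimately show ?thesis
    using assms Lambda_quotient_pos[of k "2 * real N" m] by simp
qed

lemma Lambda_quotient_poly_roots:
  assumes m: "even m \<or> 0 < N" and zero: "poly (map_poly complex_of_real (Lambda_quotient_poly N m)) w = 0"
  shows "norm w = 1"
proof (rule self_reciprocal_roots_on_unit_circle[where \<epsilon> = "(-1) ^ m", OF _ _ _ _ _ _ zero])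
  note top = coeff_Lambda_quotient_poly_top[OF m]
  show "degree (Lambda_quotient_poly N m) = 2 * N"
    using top by (intro antisym degree_le le_degree) (auto simp: coeff_Lambda_quotient_poly)
  show "Lambda_quotient_poly N m \<noteq> 0"
    using top by auto
qed (use coeff_Lambda_quotient_poly_reflect coeff_Lambda_quotient_poly_middle coeff_Lambda_quotient_poly_mono
    in \<open>auto simp del: add_Suc_right\<close>)

lemma period_poly_deriv_term:
  assumes l: "l \<le> 2 * N"
  shows "of_nat ((k - 2) choose (2 * l + 1)) * \<i> powi (1 - int (2 * l + 1)) *
      (deriv ^^ m) (completed_L_tilde (eisenstein_E k)) (of_nat (2 * l + 1 + 1)) * z ^ (k - 3 - (2 * l + 1)) =
    Lambda_const k * fact (k - 2) * (Lambda_quotient k m (of_nat (2 * l + 2)) * (- (z ^ 2)) ^ (2 * N - l))"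
proof -
  define s where "s = complex_of_nat (2 * l + 1 + 1)"
  have "2 < k" "4 dvd k" "0 < k" by (simp_all add: k)
  have ball: "s \<in> ball (of_nat k / 2) (real k / 2 - 1)"
    using even_point_in_ball[OF l] by (simp add: s_def)
  have "(deriv ^^ m) (completed_L_tilde (eisenstein_E k)) s = Lambda_const k * (deriv ^^ m) (Lambda_strip k) s"
    using ball ball_subset_critical_strip[of k] unfolding s_def
    by (intro higher_deriv_completed_L_tilde \<open>4 dvd k\<close> \<open>0 < k\<close>) auto
  hence deriv: "(deriv ^^ m) (completed_L_tilde (eisenstein_E k)) s =
      Lambda_const k * (Gamma s * Gamma (of_nat k - s) * Lambda_quotient k m s)"
    by (simp only: higher_deriv_Lambda_strip[OF \<open>2 < k\<close> ball])
  have "k - 2 + 2 = k" "2 * l + 1 \<le> k - 2" using l by (simp_all add: k)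
  hence binomial: "of_nat ((k - 2) choose (2 * l + 1)) * (Gamma s * Gamma (of_nat k - s)) =
        (fact (k - 2) :: complex)"
    using binomial_mult_Gamma[of "2 * l + 1" "k - 2"] by (simp only: s_def)
  have "k - 3 - (2 * l + 1) = 2 * (2 * N - l)" "even (l + (2 * N - l))" using l by (simp_all add: k)
  hence sign: "(-1) ^ l * z ^ (k - 3 - (2 * l + 1)) = (- (z ^ 2)) ^ (2 * N - l)"
    by (simp only: power_even_eq_minus_square_power neg_one_even_power mult_1)
  have "of_nat ((k - 2) choose (2 * l + 1)) * \<i> powi (1 - int (2 * l + 1)) *
      (deriv ^^ m) (completed_L_tilde (eisenstein_E k)) s * z ^ (k - 3 - (2 * l + 1)) =
    Lambda_const k * (of_nat ((k - 2) choose (2 * l + 1)) * (Gamma s * Gamma (of_nat k - s))) *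
      (Lambda_quotient k m s * ((-1) ^ l * z ^ (k - 3 - (2 * l + 1))))"
    unfolding deriv i_powi_one_minus_odd by (simp only: mult_ac)
  thus ?thesis unfolding binomial sign by (simp add: s_def)
qed

lemma period_poly_deriv_eisenstein:
  "period_poly_deriv (eisenstein_E k) k m z =
    Lambda_const k * fact (k - 2) * (-1) ^ m * poly (map_poly of_real (Lambda_quotient_poly N m)) (- (z ^ 2))"
proof -
  let ?Q = "\<lambda>l. Lambda_quotient k m (of_nat (2 * l + 2))" and ?w = "- (z ^ 2)"
  have "period_poly_deriv (eisenstein_E k) k m z =
      (\<Sum>l\<le>2 * N. of_nat ((k - 2) choose (2 * l + 1)) * \<i> powi (1 - int (2 * l + 1)) *
      (deriv ^^ m) (completed_L_tilde (eisenstein_E k)) (of_nat (2 * l + 1 + 1)) * z ^ (k - 3 - (2 * l + 1)))"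
    unfolding period_poly_deriv_def
    by (rule sum.reindex_bij_witness[of _ "\<lambda>l. 2 * l + 1" "\<lambda>n. n div 2"]) (auto simp: k elim!: oddE)
  also have "\<dots> = Lambda_const k * fact (k - 2) * (\<Sum>l\<le>2 * N. ?Q l * ?w ^ (2 * N - l))"
    unfolding sum_distrib_left by (rule sum.cong[OF refl]) (simp only: period_poly_deriv_term atMost_iff)
  also have "(\<Sum>l\<le>2 * N. ?Q l * ?w ^ (2 * N - l)) = (\<Sum>j\<le>2 * N. ?Q (2 * N - j) * ?w ^ j)"
    by (rule sum.reindex_bij_witness[of _ "\<lambda>j. 2 * N - j" "\<lambda>j. 2 * N - j"]) auto
  also have "\<dots> = (\<Sum>j\<le>2 * N. (-1) ^ m * (of_real (coeff (Lambda_quotient_poly N m) j) * ?w ^ j))"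
  proof (rule sum.cong[OF refl])
    fix j assume "j \<in> {..2 * N}"
    hence "?Q (2 * N - j) = of_real ((-1) ^ m * coeff (Lambda_quotient_poly N m) j)"
      by (simp only: coeff_Lambda_quotient_poly_reflect[symmetric] of_real_coeff_Lambda_quotient_poly
          diff_le_self atMost_iff)
    thus "?Q (2 * N - j) * ?w ^ j = (-1) ^ m * (of_real (coeff (Lambda_quotient_poly N m) j) * ?w ^ j)"
      by (simp add: mult_ac)
  qed
  also have "\<dots> = (-1) ^ m * poly (map_poly of_real (Lambda_quotient_poly N m)) ?w"
    by (simp only: map_poly_Lambda_quotient_poly poly_sum poly_monom sum_distrib_left)
  finally show ?thesis by (simp only: mult.assoc)
qed

end

theorem theorem4p2:
  fixes k m :: nat
  assumes "k > 0" and "[k = 0] (mod 4)" and "m \<ge> 1"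
    and nondegenerate: "\<not> (k = 4 \<and> odd m)"
  shows "\<forall>z. period_poly_deriv (eisenstein_E k) k m z = 0 \<longrightarrow> norm z = 1"
proof (intro allI impI)
  fix z assume zero: "period_poly_deriv (eisenstein_E k) k m z = 0"
  obtain q where "k = 4 * q"
    using assms(2) by (auto simp: cong_0_iff elim: dvdE)
  then obtain N where k: "k = 4 * N + 4"
    using \<open>k > 0\<close> by (cases q) auto
  have "2 \<le> k" by (simp add: k)
  hence "Lambda_const k * fact (k - 2) * (-1) ^ m \<noteq> 0"
    using Lambda_const_nonzero[of k] by simp
  hence "poly (map_poly of_real (Lambda_quotient_poly N m)) (- (z ^ 2)) = 0"
    using zero unfolding period_poly_deriv_eisenstein[OF k] by (metis mult_eq_0_iff)
  moreover have "even m \<or> 0 < N"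
    using nondegenerate k by auto
  ultimately have "norm (- (z ^ 2)) = 1"
    using Lambda_quotient_poly_roots[OF k] by blast
  hence "norm z ^ 2 = 1 ^ 2" by (simp add: norm_power)
  thus "norm z = 1" by (rule power_eq_imp_eq_base) simp_all
qed

end
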